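(* Let $t \ge 1$ be an integer and let $\mathcal{T} = (\{1, 2, \ldots, t\}, \preccurlyeq)$ be an arbitrary partially ordered set (a template). Then the class $\mathbf{K}(\mathcal{T})$ of all finite $\mathcal{T}$-multiposets has the Ramsey property. That is, for every integer $k \ge 2$ and all $\mathcal{A}, \mathcal{B} \in \mathbf{K}(\mathcal{T})$ such that $\mathcal{A}$ embeds into $\mathcal{B}$, there is a $\mathcal{C} \in \mathbf{K}(\mathcal{T})$ such that for every coloring of the copies of $\mathcal{A}$ in $\mathcal{C}$ with $k$ colors there is a copy $\mathcal{B}'$ of $\mathcal{B}$ in $\mathcal{C}$ such that all the copies of $\mathcal{A}$ that are contained in $\mathcal{B}'$ have the same color.
   Context: A template is a poset $\mathcal{T} = (\{1, 2, \ldots, t\}, \preccurlyeq)$ with $t \ge 1$. Partial orders and linear (total) orders are reflexive. A $\mathcal{T}$-multiposet is a structure $(A, \le_1, \ldots, \le_t)$ where: (1) $\le_1, \ldots, \le_t$ are partial orders on the set $A$; (2) if $i$ is a maximal element of $\mathcal{T}$, then $\le_i$ is a linear order on $A$; (3) if $i \preccurlyeq j$ in $\mathcal{T}$, then $(\le_i) \subseteq (\le_j)$ as sets of pairs. $\mathbf{K}(\mathcal{T})$ denotes the class of all $\mathcal{T}$-multiposets with a finite underlying set. An embedding of $\mathcal{A} = (A, \le_1^{\mathcal{A}}, \ldots, \le_t^{\mathcal{A}})$ into $\mathcal{B} = (B, \le_1^{\mathcal{B}}, \ldots, \le_t^{\mathcal{B}})$ is an injective map $f : A \to B$ such that $a \le_i^{\mathcal{A}}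 a' \Leftrightarrow f(a) \le_i^{\mathcal{B}} f(a')$ for all $a, a' \in A$ and all $i \in \{1, \ldots, t\}$. A substructure of $\mathcal{C}$ is a subset of its underlying set with all the relations of $\mathcal{C}$ restricted to that subset. A copy of $\mathcal{A}$ in $\mathcal{C}$ is a substructure of $\mathcal{C}$ isomorphic to $\mathcal{A}$, that is, the image of an embedding of $\mathcal{A}$ into $\mathcal{C}$. *)

theory Defs
  imports Main "HOL-Library.FuncSet"
begin

text \<open>
  Only the relations with index in \<open>{1..t}\<close> belong to a structure with \<open>t\<close> orders; the
  values of \<open>le\<close> at other indices are junk, on which no condition is imposed.
\<close>

record 'a ordstruct =
  points :: "'a set"
  le :: "nat \<Rightarrow> 'a rel"

definition template :: "nat \<Rightarrow> nat rel \<Rightarrow> bool" where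
  "template t T \<longleftrightarrow> t \<ge> 1 \<and> partial_order_on {1..t} T"

definition template_maximal :: "nat \<Rightarrow> nat rel \<Rightarrow> nat \<Rightarrow> bool" where
  "template_maximal t T i \<longleftrightarrow> i \<in> {1..t} \<and> (\<forall>j\<in>{1..t}. (i, j) \<in> T \<longrightarrow> j = i)"

definition multiposet :: "nat \<Rightarrow> nat rel \<Rightarrow> 'a ordstruct \<Rightarrow> bool" where
  "multiposet t T \<A> \<longleftrightarrow>
     (\<forall>i\<in>{1..t}. partial_order_on (points \<A>) (le \<A> i)) \<and>
     (\<forall>i\<in>{1..t}. template_maximal t T i \<longrightarrow> linear_order_on (points \<A>) (le \<A> i)) \<and>
     (\<forall>i\<in>{1..t}. \<forall>j\<in>{1..t}. (i, j) \<in> T \<longrightarrow> le \<A> i \<subseteq> le \<A> j)"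

definition fin_multiposets :: "nat \<Rightarrow> nat rel \<Rightarrow> 'a ordstruct set" where
  "fin_multiposets t T = {\<A>. multiposet t T \<A> \<and> finite (points \<A>)}"

definition embedding :: "nat \<Rightarrow> 'a ordstruct \<Rightarrow> 'b ordstruct \<Rightarrow> ('a \<Rightarrow> 'b) \<Rightarrow> bool" where
  "embedding t \<A> \<B> f \<longleftrightarrow>
     f \<in> points \<A> \<rightarrow> points \<B> \<and> inj_on f (points \<A>) \<and>
     (\<forall>i\<in>{1..t}. \<forall>a\<in>points \<A>. \<forall>a'\<in>points \<A>. (a, a') \<in> le \<A> i \<longleftrightarrow> (f a, f a') \<in> le \<B> i)"

definition embeds :: "nat \<Rightarrow> 'a ordstruct \<Rightarrow> 'b ordstruct \<Rightarrow> bool" where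
  "embeds t \<A> \<B> \<longleftrightarrow> (\<exists>f. embedding t \<A> \<B> f)"

definition isomorphic :: "nat \<Rightarrow> 'a ordstruct \<Rightarrow> 'b ordstruct \<Rightarrow> bool" where
  "isomorphic t \<A> \<B> \<longleftrightarrow> (\<exists>f. embedding t \<A> \<B> f \<and> f ` points \<A> = points \<B>)"

definition substructure :: "'a ordstruct \<Rightarrow> 'a set \<Rightarrow> 'a ordstruct" where
  "substructure \<C> S = \<lparr>points = S, le = (\<lambda>i. le \<C> i \<inter> S \<times> S)\<rparr>"

definition copies :: "nat \<Rightarrow> 'a ordstruct \<Rightarrow> 'b ordstruct \<Rightarrow> 'b ordstruct set" where
  "copies t \<A> \<C> =
     {substructure \<C> S | S. S \<subseteq> points \<C> \<and> isomorphic t \<A> (substructure \<C> S)}"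

lemma copies_eq_embedding_images:
  "copies t \<A> \<C> = {substructure \<C> (f ` points \<A>) | f. embedding t \<A> \<C> f}"
proof (intro equalityI subsetI)
  fix X assume "X \<in> copies t \<A> \<C>"
  then obtain S f where X: "X = substructure \<C> S" and S: "S \<subseteq> points \<C>"
    and f: "embedding t \<A> (substructure \<C> S) f" and im: "f ` points \<A> = S"
    unfolding copies_def isomorphic_def by (auto simp: substructure_def)
  have "embedding t \<A> \<C> f"
    using f S im unfolding embedding_def substructure_def by auto
  with X im show "X \<in> {substructure \<C> (f ` points \<A>) | f. embedding t \<A> \<C> f}" by blast
next
  fix X assume "X \<in> {substructure \<C> (f ` points \<A>) | f. embedding t \<A> \<C> f}"
  then obtain f where X: "X = substructure \<C> (f ` points \<A>)" and f: "embedding t \<A> \<C> f"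
    by blast
  have "f ` points \<A> \<subseteq> points \<C>" using f unfolding embedding_def by auto
  moreover have "embedding t \<A> (substructure \<C> (f ` points \<A>)) f"
    using f unfolding embedding_def substructure_def by auto
  ultimately show "X \<in> copies t \<A> \<C>"
    unfolding copies_def isomorphic_def X by (auto simp: substructure_def)
qed

end

(*
  For a multiposet A let F(A) be the set of pairs (p, U) with U a nonempty upset of the p-th order,
  listed by p and then so that U precedes V if the least element of their symmetric difference, in
  a linear order extending the p-th one, lies in V.  A word w of length n whose letters are elements
  of F(A) or a null letter sends a point a to the family of the sets {j. w_j = (p, U), a in U}, and
  a is below b in the p-th order iff the p-th set of a is contained in that of b.  If every letter
  of F(A) occurs in w, this embeds A into a host multiposet on all families of subsets of {..<n}
  indexed by the template, with orders read off from strict inclusions.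

  Taking preimages under an embedding of A into B maps F(B) to F(A) and the null letter, and for the
  chosen listings this is a parameter word over a one-letter alphabet, because the first upset of B
  with a given preimage is the one generated by it.  Substituting this parameter word into a
  parameter word for B gives the copy of A inside the copy of B.  So the Ramsey property of
  multiposets follows from the Graham-Rothschild theorem for parameter words.
*)

theory Submission
  imports Defs "HOL-Library.Nat_Bijection"
begin

section \<open>Parameter words\<close>

text \<open>A \<open>k\<close>-parameter word over the alphabet \<open>{..<a}\<close>: the letter \<open>a + i\<close> stands for the
  \<open>i\<close>-th parameter, all parameters occur, and their first occurrences are in increasing order.
  Counting the first parameter as one more constant after it has occurred turns the order
  condition into a structural recursion.\<close>

fun pword :: "nat \<Rightarrow> nat \<Rightarrow> nat list \<Rightarrow> bool" where
  "pword a k [] \<longleftrightarrow> k = 0"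
| "pword a k (x # xs) \<longleftrightarrow>
     x < a \<and> pword a k xs \<or> x = a \<and> (\<exists>k'. k = Suc k' \<and> pword (Suc a) k' xs)"

definition subst :: "nat \<Rightarrow> nat list \<Rightarrow> nat list \<Rightarrow> nat list" where
  "subst a v w = map (\<lambda>x. if x < a then x else v ! (x - a)) w"

lemma length_subst [simp]: "length (subst a v w) = length w"
  by (simp add: subst_def)

text \<open>New letters enter \<open>w\<close> in the order \<open>b\<close>, \<open>b + 1\<close>,
  and so on, so the new letters of \<open>map g w\<close> enter as they do in
  \<open>map g [b..<b + m]\<close>. Checking this one list settles renamings and substitutions
  alike.\<close>

lemma pword_map:
  assumes "pword b m w" "\<forall>x<b. g x < c" "pword c k (map g [b..<b + m])"
  shows "pword c k (map g w)"
  using assms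
proof (induction w arbitrary: b c k m)
  case Nil
  then show ?case by simp
next
  case (Cons x w)
  show ?case
  proof (cases "x < b")
    case True
    with Cons show ?thesis by auto
  next
    case False
    with Cons.prems obtain m' where m: "x = b" "m = Suc m'" "pword (Suc b) m' w" by auto
    have "[b..<b + m] = b # [Suc b..<Suc b + m']" using m by (simp add: upt_conv_Cons)
    \<comment> \<open>Once \<open>b\<close> has occurred it counts as a constant of
      \<open>w\<close>. Its image is either an old constant or the first parameter \<open>c\<close>,
      which then becomes a constant too.\<close>
    with Cons.prems(3) consider "g b < c" "pword c k (map g [Suc b..<Suc b + m'])"
      | k' where "g b = c" "k = Suc k'" "pword (Suc c) k' (map g [Suc b..<Suc b + m'])"
      by auto
    then show ?thesis
    proof cases
      case 1
      with Cons.IH[OF m(3)] Cons.prems(2) m show ?thesis by (auto simp: less_Suc_eq)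
    next
      case 2
      have "\<forall>x<Suc b. g x < Suc c" using 2 Cons.prems(2) by (auto simp: less_Suc_eq)
      with 2 Cons.IH[OF m(3)] m show ?thesis by auto
    qed
  qed
qed

text \<open>All parameters of \<open>u\<close> have occurred when \<open>w\<close> begins, so they
  serve as constants there.\<close>

lemma pword_append: "pword a m u \<Longrightarrow> pword (a + m) k w \<Longrightarrow> pword a (m + k) (u @ w)"
proof (induction u arbitrary: a m)
  case (Cons x u)
  show ?case
  proof (cases "x < a")
    case False
    with Cons.prems obtain m' where "x = a" "m = Suc m'" "pword (Suc a) m' u" by auto
    with Cons.IH[of "Suc a" m'] Cons.prems(2) show ?thesis by auto
  qed (use Cons in auto)
qed auto

lemma pword_zero_iff: "pword a 0 w \<longleftrightarrow> set w \<subseteq> {..<a}"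
  by (induction w) auto

lemma pword_upt: "pword a m [a..<a + m]"
proof (induction m arbitrary: a)
  case (Suc m)
  have "[a..<a + Suc m] = a # [Suc a..<Suc a + m]" by (simp add: upt_conv_Cons)
  with Suc[of "Suc a"] show ?case by simp
qed simp

lemma pword_set: "pword a k w \<Longrightarrow> set w \<subseteq> {..<a + k} \<and> {a..<a + k} \<subseteq> set w"
proof (induction w arbitrary: a k)
  case (Cons x w)
  show ?case
  proof (cases "x < a")
    case False
    with Cons.prems obtain k' where k: "x = a" "k = Suc k'" "pword (Suc a) k' w" by auto
    have "{a..<a + k} = insert a {Suc a..<Suc a + k'}" using k by auto
    with Cons.IH[OF k(3)] k show ?thesis by auto
  qed (use Cons in fastforce)
qed auto

lemma pword_rename:
  assumes "pword b m w" "\<forall>x<b. g x < c" "\<And>i. i < m \<Longrightarrow> g (b + i) = c + i"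
  shows "pword c m (map g w)"
proof (rule pword_map[OF assms(1,2)])
  have "map g [b..<b + m] = [c..<c + m]"
    using assms(3) by (auto intro!: nth_equalityI)
  then show "pword c m (map g [b..<b + m])" using pword_upt by simp
qed

text \<open>The identity word is neutral for substitution; this is the list of images that
  \<open>pword_map\<close> asks for in \<open>pword_subst\<close>.\<close>

lemma subst_upt: "map (\<lambda>x. if x < a then x else v ! (x - a)) [a..<a + length v] = v"
  by (auto intro!: nth_equalityI)

lemma pword_subst:
  assumes "pword a m w" "pword a k v" "length v = m"
  shows "pword a k (subst a v w)"
  unfolding subst_def using assms subst_upt[of a v] by (intro pword_map[OF assms(1)]) auto

text \<open>The bound on the letters of \<open>w\<close> keeps every index into \<open>v\<close> in
  range. Associativity makes a subspace of a subspace a subspace, which all the compositions below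
  rely on.\<close>

lemma subst_assoc:
  assumes "set w \<subseteq> {..<a + length v}"
  shows "subst a u (subst a v w) = subst a (subst a u v) w"
  using assms by (auto simp: subst_def)

lemma subst_take:
  assumes "set w \<subseteq> {..<a + p}"
  shows "subst a v w = subst a (take p v) w"
  using assms by (auto simp: subst_def)

text \<open>A parameter above \<open>q\<close> enters only after \<open>q\<close> has, so the first
  letter not below \<open>q\<close>, if there is one, is \<open>q\<close> itself, and there
  \<open>Q\<close> fails.\<close>

lemma takeWhile_pword:
  assumes "pword a m w" "a \<le> q" "\<forall>x<q. Q x" "q < a + m \<longrightarrow> \<not> Q q"
  shows "takeWhile Q w = takeWhile (\<lambda>x. x < q) w"
  using assms
proof (induction w arbitrary: a m)
  case (Cons x w)
  show ?case
  proof (cases "x < a")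
    case True
    with Cons show ?thesis by auto
  next
    case False
    with Cons.prems obtain m' where m: "x = a" "m = Suc m'" "pword (Suc a) m' w" by auto
    with Cons.IH[OF m(3)] Cons.prems show ?thesis by (cases "a = q") auto
  qed
qed simp

text \<open>The first letter of \<open>v\<close> outside \<open>{..<a + j}\<close> stands at place
  \<open>p\<close>, so the composite first leaves this range where \<open>a + p\<close> first occurs
  in \<open>w\<close>; if there is none, \<open>p = m\<close> and nothing is cut off. Thus initial
  segments of composites are composites of initial segments.\<close>

lemma takeWhile_subst:
  fixes j :: nat
  assumes w: "pword a m w" and v: "length v = m"
  defines "p \<equiv> length (takeWhile (\<lambda>x. x < a + j) v)"
  shows "takeWhile (\<lambda>x. x < a + j) (subst a v w) =
    subst a (take p v) (takeWhile (\<lambda>x. x < a + p) w)"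
proof -
  have le: "p \<le> m" unfolding p_def using v length_takeWhile_le by blast
  have "takeWhile (\<lambda>x. (if x < a then x else v ! (x - a)) < a + j) w = takeWhile (\<lambda>x. x < a + p) w"
  proof (rule takeWhile_pword[OF w])
    have "v ! i < a + j" if "i < p" for i
      using that by (metis p_def nth_mem set_takeWhileD takeWhile_nth)
    then show "\<forall>x<a + p. (if x < a then x else v ! (x - a)) < a + j" by auto
    show "a + p < a + m \<longrightarrow> \<not> (if a + p < a then a + p else v ! (a + p - a)) < a + j"
      using v nth_length_takeWhile[of "\<lambda>x. x < a + j" v] by (auto simp: p_def)
  qed simp
  then have "takeWhile (\<lambda>x. x < a + j) (subst a v w) = subst a v (takeWhile (\<lambda>x. x < a + p) w)"
    by (simp add: subst_def takeWhile_map o_def)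
  also have "\<dots> = subst a (take p v) (takeWhile (\<lambda>x. x < a + p) w)"
    by (rule subst_take) (auto dest: set_takeWhileD)
  finally show ?thesis .
qed

text \<open>A colouring that records several colours at once must again have values in
  \<open>nat\<close>, hence the encoding.\<close>

definition colour_tuples :: "nat set \<Rightarrow> nat \<Rightarrow> nat set" where
  "colour_tuples C a = list_encode ` {xs. set xs \<subseteq> C \<and> length xs = a}"

lemma finite_colour_tuples: "finite C \<Longrightarrow> finite (colour_tuples C a)"
  by (simp add: colour_tuples_def finite_lists_length_eq)

definition colour_tuple :: "nat \<Rightarrow> (nat \<Rightarrow> nat) \<Rightarrow> nat" where
  "colour_tuple a f = list_encode (map f [0..<a])"

lemma colour_tuple_in: "(\<And>x. f x \<in> C) \<Longrightarrow> colour_tuple a f \<in> colour_tuples C a"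
  unfolding colour_tuple_def colour_tuples_def by (rule imageI) auto

lemma colour_tuple_nth: "x < a \<Longrightarrow> list_decode (colour_tuple a f) ! x = f x"
  by (simp add: colour_tuple_def)

section \<open>The Graham-Rothschild theorem\<close>

text \<open>The Graham-Rothschild arrow; \<open>k = 0\<close> is the Hales-Jewett property.
  Colourings are total on lists, so they can be composed freely with substitutions.\<close>

definition arrows :: "nat \<Rightarrow> nat \<Rightarrow> nat \<Rightarrow> nat set \<Rightarrow> bool" where
  "arrows a k m C \<longleftrightarrow> (\<exists>n. \<forall>\<chi>. range \<chi> \<subseteq> C \<longrightarrow>
     (\<exists>w c. length w = n \<and> pword a m w \<and>
        (\<forall>v. length v = m \<longrightarrow> pword a k v \<longrightarrow> \<chi> (subst a v w) = c)))"

section \<open>The Hales-Jewett theorem\<close>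

text \<open>Shelah's argument: among the words \<open>(b + 1)\<^sup>i b\<^sup>N\<^sup>-\<^sup>i\<close> with \<open>i \<le> N\<close>, two give the same colouring of
  the tails; the block with the parameter at the places where they differ does not distinguish
  \<open>b\<close> from \<open>b + 1\<close>.\<close>

lemma insensitive_subspace:
  fixes b L :: nat
  assumes "finite C"
  defines "A \<equiv> Suc (Suc b)"
  shows "\<exists>n. \<forall>\<chi>. range \<chi> \<subseteq> C \<longrightarrow> (\<exists>w. length w = n \<and> pword A L w \<and>
    (\<forall>f. length f = L \<longrightarrow> set f \<subseteq> {..<A} \<longrightarrow>
       \<chi> (subst A f w) = (\<chi> (subst A (map (min b) f) w) :: nat)))"
  using assms(1)
proof (induction L arbitrary: C)
  case 0
  show ?case by (intro exI[of _ 0] allI impI exI[of _ "[]"]) auto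
next
  case (Suc L)
  obtain n' where n': "\<forall>\<chi>. range \<chi> \<subseteq> colour_tuples C A \<longrightarrow> (\<exists>w. length w = n' \<and> pword A L w \<and>
    (\<forall>f. length f = L \<longrightarrow> set f \<subseteq> {..<A} \<longrightarrow> \<chi> (subst A f w) = \<chi> (subst A (map (min b) f) w)))"
    using Suc.IH[OF finite_colour_tuples[OF Suc.prems]] ..
  define Y where "Y = {y. set y \<subseteq> {..<A} \<and> length y = n'}"
  define V where "V = (Y \<rightarrow>\<^sub>E C)"
  \<comment> \<open>There are \<open>N + 1\<close> prefixes \<open>T i\<close> but only
    \<open>N\<close> colourings of the tails.\<close>
  define N where "N = card V"
  have "finite Y" unfolding Y_def by (rule finite_lists_length_eq) simp
  then have "finite V" unfolding V_def using Suc.prems by (intro finite_PiE) auto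
  show ?case
  proof (rule exI[of _ "N + n'"], intro allI impI)
    fix \<chi> :: "nat list \<Rightarrow> nat" assume \<chi>: "range \<chi> \<subseteq> C"
    define T where "T i = replicate i (Suc b) @ replicate (N - i) b" for i
    define g where "g i = (\<lambda>y\<in>Y. \<chi> (T i @ y))" for i
    have "g ` {..N} \<subseteq> V" unfolding g_def V_def using \<chi> by auto
    then have "card (g ` {..N}) \<le> N" unfolding N_def using \<open>finite V\<close> by (rule card_mono[rotated])
    then have "\<not> inj_on g {..N}" by (auto dest: card_image)
    then obtain i j where ij: "i < j" "j \<le> N" "g i = g j"
      unfolding inj_on_def by (metis atMost_iff linorder_neqE_nat)
    \<comment> \<open>With \<open>b\<close> put for its parameter \<open>A\<close>, this block is
      \<open>T i\<close>; with \<open>b + 1\<close> it is \<open>T j\<close>.\<close>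
    define B where "B = replicate i (Suc b) @ replicate (j - i) A @ replicate (N - j) b"
    have "pword (Suc A) 0 (replicate (j - Suc i) A @ replicate (N - j) b)"
      unfolding pword_zero_iff A_def by auto
    moreover have "j - i = Suc (j - Suc i)" using ij by simp
    ultimately have "pword A (0 + 1) B"
      unfolding B_def by (intro pword_append) (auto simp: pword_zero_iff A_def)
    then have pB: "pword A 1 B" by simp
    have lB: "length B = N" using ij by (simp add: B_def)
    have Bb: "subst A (b # f) B = T i" for f
      using ij by (auto simp: B_def T_def subst_def A_def simp flip: replicate_add)
    have BSb: "subst A (Suc b # f) B = T j" for f
      using ij by (auto simp: B_def T_def subst_def A_def append_assoc[symmetric] simp del: append_assoc simp flip: replicate_add)
    \<comment> \<open>The tuple runs over the letters put for the parameter of \<open>B\<close>, so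
      one application of the induction hypothesis serves every first letter.\<close>
    define \<chi>' where "\<chi>' u = colour_tuple A (\<lambda>x. \<chi> (subst A [x] B @ u))" for u
    have "range \<chi>' \<subseteq> colour_tuples C A"
      unfolding \<chi>'_def using \<chi> by (auto intro: colour_tuple_in)
    from n'[rule_format, OF this] obtain w' where w': "length w' = n'" "pword A L w'"
      "\<And>f. length f = L \<Longrightarrow> set f \<subseteq> {..<A} \<Longrightarrow> \<chi>' (subst A f w') = \<chi>' (subst A (map (min b) f) w')"
      by blast
    define w where "w = B @ map (\<lambda>y. if y < A then y else Suc y) w'"
    have "pword (A + 1) L (map (\<lambda>y. if y < A then y else Suc y) w')"
      by (rule pword_rename[OF w'(2)]) auto
    with pword_append[OF pB] have "pword A (Suc L) w" by (simp add: w_def)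
    moreover have sub: "subst A (x # f) w = subst A [x] B @ subst A f w'" for x f
      using pword_set[OF pB] by (auto simp: w_def subst_def)
    have "\<chi> (subst A f w) = \<chi> (subst A (map (min b) f) w)"
      if f: "length f = Suc L" "set f \<subseteq> {..<A}" for f
    proof -
      obtain x f' where [simp]: "f = x # f'" using f by (cases f) auto
      define y where "y = subst A (map (min b) f') w'"
      have x: "x < A" and f': "length f' = L" "set f' \<subseteq> {..<A}" using f by auto
      \<comment> \<open>On this alphabet \<open>min b\<close> only merges \<open>b + 1\<close> with
        \<open>b\<close>. The tail is collapsed first, for fixed \<open>x\<close>; the first letter
        then follows because \<open>T i\<close> and \<open>T j\<close> agree on tails.\<close>
      have "\<chi> (subst A f w) = \<chi> (subst A [x] B @ subst A f' w')" by (simp add: sub)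
      also have "\<dots> = \<chi> (subst A [x] B @ y)"
        using w'(3)[OF f'] colour_tuple_nth[OF x] unfolding \<chi>'_def y_def by metis
      also have "\<dots> = \<chi> (subst A [min b x] B @ y)"
      proof (cases "x = Suc b")
        case True
        have "pword A 0 (map (min b) f')" by (auto simp: pword_zero_iff A_def)
        then have "y \<in> Y"
          using pword_subst[OF w'(2), of 0] f' w'(1) by (simp add: Y_def y_def pword_zero_iff)
        then have "\<chi> (T i @ y) = \<chi> (T j @ y)"
          using fun_cong[OF ij(3), of y] by (simp add: g_def)
        then show ?thesis using True by (simp add: Bb BSb)
      next
        case False
        then have "min b x = x" using x by (simp add: A_def)
        then show ?thesis by simp
      qed
      also have "\<dots> = \<chi> (subst A (map (min b) f) w)" by (simp add: sub y_def)
      finally show ?thesis .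
    qed
    ultimately show "\<exists>w. length w = N + n' \<and> pword A (Suc L) w \<and>
      (\<forall>f. length f = Suc L \<longrightarrow> set f \<subseteq> {..<A} \<longrightarrow> \<chi> (subst A f w) = \<chi> (subst A (map (min b) f) w))"
      using w'(1) lB by (intro exI[of _ w]) (simp add: w_def)
  qed
qed

text \<open>Induction on the alphabet: in a subspace whose colours do not distinguish
  \<open>b\<close> from \<open>b + 1\<close>, only words over the smaller alphabet matter, and the
  smaller case applies inside it. Over one letter there is just one constant word of each
  length.\<close>

theorem Hales_Jewett:
  assumes "finite C"
  shows "arrows (Suc b) 0 m C"
proof (induction b arbitrary: m)
  case 0
  define w where "w = [Suc 0..<Suc 0 + m]"
  have w: "length w = m" "pword (Suc 0) m w" unfolding w_def by (simp, rule pword_upt)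
  have v: "v = replicate m 0" if "length v = m" "pword (Suc 0) 0 v" for v
    using that by (intro replicate_eqI) (auto simp: pword_zero_iff)
  have "\<chi> (subst (Suc 0) v w) = \<chi> (subst (Suc 0) (replicate m 0) w)"
    if "length v = m" "pword (Suc 0) 0 v" for v and \<chi> :: "nat list \<Rightarrow> nat"
    using v[OF that] by simp
  with w show ?case unfolding arrows_def by blast
next
  case (Suc b)
  define A where "A = Suc (Suc b)"
  obtain M where M: "\<forall>\<chi>. range \<chi> \<subseteq> C \<longrightarrow> (\<exists>w c. length w = M \<and> pword (Suc b) m w \<and>
        (\<forall>v. length v = m \<longrightarrow> pword (Suc b) 0 v \<longrightarrow> \<chi> (subst (Suc b) v w) = c))"
    using Suc[of m] unfolding arrows_def ..
  obtain n where n: "\<forall>\<chi>. range \<chi> \<subseteq> C \<longrightarrow> (\<exists>w. length w = n \<and> pword A M w \<and>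
    (\<forall>f. length f = M \<longrightarrow> set f \<subseteq> {..<A} \<longrightarrow>
       \<chi> (subst A f w) = \<chi> (subst A (map (min b) f) w)))"
    using insensitive_subspace[OF assms, where L = M and b = b] unfolding A_def ..
  show ?case unfolding arrows_def A_def[symmetric]
  proof (intro exI[of _ n] allI impI)
    fix \<chi> :: "nat list \<Rightarrow> nat" assume \<chi>: "range \<chi> \<subseteq> C"
    obtain w1 where w1: "length w1 = n" "pword A M w1"
      "\<And>f. length f = M \<Longrightarrow> set f \<subseteq> {..<A} \<Longrightarrow> \<chi> (subst A f w1) = \<chi> (subst A (map (min b) f) w1)"
      using n[rule_format, OF \<chi>] by blast
    have "range (\<lambda>f. \<chi> (subst A f w1)) \<subseteq> C" using \<chi> by auto
    from M[rule_format, OF this] obtain w2 c where w2: "length w2 = M" "pword (Suc b) m w2"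
      "\<And>v. length v = m \<Longrightarrow> pword (Suc b) 0 v \<Longrightarrow> \<chi> (subst A (subst (Suc b) v w2) w1) = c"
      by blast
    \<comment> \<open>The parameters move up by one because \<open>Suc b\<close> is now a constant;
      it does not occur in \<open>w2'\<close>.\<close>
    define w2' where "w2' = map (\<lambda>y. if y < Suc b then y else Suc y) w2"
    have w2': "pword A m w2'"
      unfolding w2'_def by (rule pword_rename[OF w2(2)]) (auto simp: A_def)
    have lw2': "length w2' = M" using w2 by (simp add: w2'_def)
    have "pword A m (subst A w2' w1)" using pword_subst[OF w1(2) w2'] lw2' by simp
    moreover have "\<chi> (subst A f (subst A w2' w1)) = c" if f: "length f = m" "pword A 0 f" for f
    proof -
      have "pword A 0 (subst A f w2')" using pword_subst[OF w2'] f by simp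
      then have sf: "set (subst A f w2') \<subseteq> {..<A}" by (simp add: pword_zero_iff)
      have "subst A f (subst A w2' w1) = subst A (subst A f w2') w1"
        using pword_set[OF w1(2)] lw2' by (intro subst_assoc) auto
      then have "\<chi> (subst A f (subst A w2' w1)) = \<chi> (subst A (map (min b) (subst A f w2')) w1)"
        using w1(3)[OF _ sf] lw2' by simp
      also have "map (min b) (subst A f w2') = subst (Suc b) (map (min b) f) w2"
        using pword_set[OF w2(2)] f(1) by (auto simp: subst_def w2'_def A_def)
      also have "\<chi> (subst A \<dots> w1) = c"
        using f by (intro w2(3)) (auto simp: pword_zero_iff)
      finally show ?thesis .
    qed
    ultimately show "\<exists>w c. length w = n \<and> pword A m w \<and>
      (\<forall>v. length v = m \<longrightarrow> pword A 0 v \<longrightarrow> \<chi> (subst A v w) = c)"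
      using w1(1) by (intro exI[of _ "subst A w2' w1"] exI[of _ c]) simp
  qed
qed

section \<open>The Carlson-Simpson theorem\<close>

text \<open>\<open>takeWhile (\<lambda>x. x < a + j) w\<close> is the part of \<open>w\<close> before its \<open>j\<close>-th parameter, and all of \<open>w\<close>
  if \<open>j\<close> is the number of parameters.\<close>

lemma Carlson_Simpson_levels:
  assumes "finite C"
  shows "\<exists>L. \<forall>\<chi>. range \<chi> \<subseteq> C \<longrightarrow> (\<exists>w \<gamma>. length w = L \<and> pword (Suc b) M w \<and>
    (\<forall>v. length v \<le> M \<longrightarrow> set v \<subseteq> {..<Suc b} \<longrightarrow>
      \<chi> (subst (Suc b) v (takeWhile (\<lambda>x. x < Suc b + length v) w)) = (\<gamma> (length v) :: nat)))"
proof (induction M)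
  case 0
  show ?case
    by (intro exI[of _ 0] allI impI exI[of _ "[]"]) (auto simp: subst_def)
next
  case (Suc M)
  define a where "a = Suc b"
  obtain L where L: "\<forall>\<chi>. range \<chi> \<subseteq> C \<longrightarrow> (\<exists>w \<gamma>. length w = L \<and> pword a M w \<and>
    (\<forall>v. length v \<le> M \<longrightarrow> set v \<subseteq> {..<a} \<longrightarrow>
      \<chi> (subst a v (takeWhile (\<lambda>x. x < a + length v) w)) = \<gamma> (length v)))"
    using Suc unfolding a_def ..
  \<comment> \<open>Hales-Jewett treats only the full words. The parameter beyond \<open>L\<close>
    separates them from the shorter ones, which the induction hypothesis treats.\<close>
  obtain n where n: "\<forall>\<chi>. range \<chi> \<subseteq> C \<longrightarrow> (\<exists>w c. length w = n \<and> pword a (Suc L) w \<and>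
        (\<forall>v. length v = Suc L \<longrightarrow> pword a 0 v \<longrightarrow> \<chi> (subst a v w) = c))"
    using Hales_Jewett[OF assms, where b = b and m = "Suc L"] unfolding arrows_def a_def ..
  show ?case unfolding a_def[symmetric]
  proof (intro exI[of _ n] allI impI)
    fix \<chi> :: "nat list \<Rightarrow> nat" assume \<chi>: "range \<chi> \<subseteq> C"
    obtain w1 c where w1: "length w1 = n" "pword a (Suc L) w1"
      "\<And>v. length v = Suc L \<Longrightarrow> pword a 0 v \<Longrightarrow> \<chi> (subst a v w1) = c"
      using n[rule_format, OF \<chi>] by blast
    define \<chi>' where "\<chi>' g = \<chi> (subst a g (takeWhile (\<lambda>x. x < a + length g) w1))" for g
    have "range \<chi>' \<subseteq> C" using \<chi> by (auto simp: \<chi>'_def)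
    from L[rule_format, OF this] obtain w2 \<gamma> where w2: "length w2 = L" "pword a M w2"
      "\<And>v. length v \<le> M \<Longrightarrow> set v \<subseteq> {..<a} \<Longrightarrow>
      \<chi>' (subst a v (takeWhile (\<lambda>x. x < a + length v) w2)) = \<gamma> (length v)"
      by blast
    \<comment> \<open>All of \<open>w2\<close> stands before the appended parameter, so level
      \<open>M\<close> is still governed by the induction hypothesis, while all of
      \<open>w2'\<close> gives level \<open>Suc M\<close>.\<close>
    define w2' where "w2' = w2 @ [a + M]"
    define w where "w = subst a w2' w1"
    have pw2': "pword a (Suc M) w2'"
      using pword_append[OF w2(2), of 1 "[a + M]"] by (simp add: w2'_def)
    have lw2': "length w2' = Suc L" using w2(1) by (simp add: w2'_def)
    have pw: "pword a (Suc M) w"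
      unfolding w_def using pword_subst[OF w1(2) pw2'] lw2' by simp
    have "\<chi> (subst a v (takeWhile (\<lambda>x. x < a + length v) w)) = (\<gamma>(Suc M := c)) (length v)"
      if v: "length v \<le> Suc M" "set v \<subseteq> {..<a}" for v
    proof (cases "length v = Suc M")
      case True
      have whole: "takeWhile (\<lambda>x. x < a + length v) w = w"
        using pword_set[OF pw] True by (auto simp: takeWhile_eq_all_conv)
      have assoc: "subst a v w = subst a (subst a v w2') w1"
        unfolding w_def using pword_set[OF w1(2)] lw2' by (intro subst_assoc) auto
      have "pword a 0 (subst a v w2')"
        using pword_subst[OF pw2', of 0 v] v True by (simp add: pword_zero_iff)
      from w1(3)[OF _ this] show ?thesis unfolding whole assoc using True lw2' by simp
    next
      case False
      define j where "j = length v"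
      have j: "j \<le> M" using False v by (simp add: j_def)
      define u where "u = takeWhile (\<lambda>x. x < a + j) w2"
      have tu: "takeWhile (\<lambda>x. x < a + j) w2' = u"
        using j by (auto simp: w2'_def u_def takeWhile_append) (metis takeWhile_eq_all_conv)
      define p where "p = length u"
      have "p \<le> L" unfolding p_def u_def using w2(1) length_takeWhile_le by blast
      have "take p w2' = u"
        unfolding p_def tu[symmetric] by (metis takeWhile_eq_take)
      then have "takeWhile (\<lambda>x. x < a + j) w = subst a u (takeWhile (\<lambda>x. x < a + p) w1)"
        unfolding w_def takeWhile_subst[OF w1(2) lw2'] tu by (simp add: p_def)
      moreover have "subst a v (subst a u (takeWhile (\<lambda>x. x < a + p) w1)) =
          subst a (subst a v u) (takeWhile (\<lambda>x. x < a + p) w1)"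
        by (rule subst_assoc) (auto simp: p_def dest: set_takeWhileD)
      ultimately have "\<chi> (subst a v (takeWhile (\<lambda>x. x < a + j) w)) = \<chi>' (subst a v u)"
        by (simp add: \<chi>'_def p_def)
      also have "\<dots> = \<gamma> j"
        using w2(3)[of v] v j unfolding u_def j_def by simp
      finally show ?thesis using False by (simp add: j_def)
    qed
    with pw show "\<exists>w \<gamma>. length w = n \<and> pword a (Suc M) w \<and>
      (\<forall>v. length v \<le> Suc M \<longrightarrow> set v \<subseteq> {..<a} \<longrightarrow>
        \<chi> (subst a v (takeWhile (\<lambda>x. x < a + length v) w)) = \<gamma> (length v))"
      using w1(1) by (intro exI[of _ w] exI[of _ "\<gamma>(Suc M := c)"]) (simp add: w_def)
  qed
qed

text \<open>The construction puts the parameters at the first \<open>m\<close> places of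
  \<open>c\<close> in \<open>cs\<close> and the constant \<open>0\<close> everywhere else;
  \<open>0\<close> is available because the alphabet is not empty.\<close>

lemma pword_select:
  assumes "m \<le> count_list cs c"
  shows "\<exists>v. length v = length cs \<and> pword (Suc b) m v \<and>
    (\<forall>j<m. length (takeWhile (\<lambda>x. x < Suc b + j) v) < length cs \<and>
      cs ! length (takeWhile (\<lambda>x. x < Suc b + j) v) = c)"
  using assms
proof (induction cs arbitrary: m rule: rev_induct)
  case Nil
  then show ?case by simp
next
  case (snoc d cs)
  show ?case
  proof (cases "m \<le> count_list cs c")
    case True
    then obtain v where v: "length v = length cs" "pword (Suc b) m v"
      "\<forall>j<m. length (takeWhile (\<lambda>x. x < Suc b + j) v) < length cs \<and>
        cs ! length (takeWhile (\<lambda>x. x < Suc b + j) v) = c"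
      using snoc.IH by blast
    have "takeWhile (\<lambda>x. x < Suc b + j) (v @ [0]) = takeWhile (\<lambda>x. x < Suc b + j) v" if "j < m" for j
    proof -
      have "takeWhile (\<lambda>x. x < Suc b + j) v \<noteq> v" using v(1) v(3)[rule_format, OF that] by (metis less_irrefl)
      then obtain x where "x \<in> set v" "\<not> x < Suc b + j" using takeWhile_eq_all_conv by blast
      then show ?thesis by (rule takeWhile_append1)
    qed
    moreover have "pword (Suc b) m (v @ [0])"
      using pword_append[OF v(2), of 0 "[0]"] by simp
    ultimately show ?thesis using v by (intro exI[of _ "v @ [0]"]) (auto simp: nth_append)
  next
    case False
    with snoc.prems have d: "d = c" "m = Suc (count_list cs c)" by (auto split: if_splits)
    define m' where "m' = count_list cs c"
    obtain v where v: "length v = length cs" "pword (Suc b) m' v"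
      "\<forall>j<m'. length (takeWhile (\<lambda>x. x < Suc b + j) v) < length cs \<and>
        cs ! length (takeWhile (\<lambda>x. x < Suc b + j) v) = c"
      using snoc.IH[of m'] m'_def by blast
    let ?v = "v @ [Suc b + m']"
    have "pword (Suc b) m ?v"
      using pword_append[OF v(2), of 1 "[Suc b + m']"] d by (simp add: m'_def)
    moreover have "takeWhile (\<lambda>x. x < Suc b + j) ?v = takeWhile (\<lambda>x. x < Suc b + j) v" if "j < m'" for j
    proof -
      have "takeWhile (\<lambda>x. x < Suc b + j) v \<noteq> v" using v(1) v(3)[rule_format, OF that] by (metis less_irrefl)
      then obtain x where "x \<in> set v" "\<not> x < Suc b + j" using takeWhile_eq_all_conv by blast
      then show ?thesis by (rule takeWhile_append1)
    qed
    moreover have "takeWhile (\<lambda>x. x < Suc b + m') ?v = v"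
      using pword_set[OF v(2)] by (auto simp: takeWhile_append takeWhile_eq_all_conv)
    ultimately show ?thesis using v d
      by (intro exI[of _ ?v]) (auto simp: nth_append less_Suc_eq m'_def[symmetric])
  qed
qed

text \<open>Pigeonhole on levels: among \<open>m * card C\<close> levels some colour occurs
  \<open>m\<close> times, and \<open>pword_select\<close> places the parameters at such
  levels.\<close>

lemma Carlson_Simpson:
  assumes "finite C"
  shows "\<exists>L. \<forall>\<chi>. range \<chi> \<subseteq> C \<longrightarrow> (\<exists>w c. length w = L \<and> pword (Suc b) m w \<and>
    (\<forall>v. length v < m \<longrightarrow> set v \<subseteq> {..<Suc b} \<longrightarrow>
      \<chi> (subst (Suc b) v (takeWhile (\<lambda>x. x < Suc b + length v) w)) = (c :: nat)))"
proof -
  define a where "a = Suc b"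
  define M where "M = m * card C"
  obtain L where L: "\<forall>\<chi>. range \<chi> \<subseteq> C \<longrightarrow> (\<exists>w \<gamma>. length w = L \<and> pword a M w \<and>
    (\<forall>v. length v \<le> M \<longrightarrow> set v \<subseteq> {..<a} \<longrightarrow>
      \<chi> (subst a v (takeWhile (\<lambda>x. x < a + length v) w)) = \<gamma> (length v)))"
    using Carlson_Simpson_levels[OF assms, where b = b and M = M] unfolding a_def ..
  show ?thesis unfolding a_def[symmetric]
  proof (intro exI[of _ L] allI impI)
    fix \<chi> :: "nat list \<Rightarrow> nat" assume \<chi>: "range \<chi> \<subseteq> C"
    from L[rule_format, OF this] obtain w \<gamma> where w: "length w = L" "pword a M w"
      "\<And>v. length v \<le> M \<Longrightarrow> set v \<subseteq> {..<a} \<Longrightarrow>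
        \<chi> (subst a v (takeWhile (\<lambda>x. x < a + length v) w)) = \<gamma> (length v)"
      by blast
    define cs where "cs = map \<gamma> [0..<M]"
    \<comment> \<open>The word of \<open>j\<close> zeros attains the value of
      \<open>\<gamma>\<close> at level \<open>j\<close>, so this value is a colour.\<close>
    have \<gamma>: "\<gamma> j \<in> C" if "j \<le> M" for j
    proof -
      have "set (replicate j 0) \<subseteq> {..<a}" by (auto simp: a_def)
      then have "\<gamma> j = \<chi> (subst a (replicate j 0) (takeWhile (\<lambda>x. x < a + j) w))"
        using w(3)[of "replicate j 0"] that by simp
      then show ?thesis using \<chi> by auto
    qed
    have "\<exists>c. m \<le> count_list cs c"
    proof (rule ccontr)
      assume "\<not> ?thesis"
      then have less: "count_list cs c < m" for c by (simp add: not_le)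
      have "C \<noteq> {}" using \<chi> by blast
      then have "sum (count_list cs) C < (\<Sum>c\<in>C. m)"
        using less assms by (intro sum_strict_mono) auto
      moreover have "sum (count_list cs) C = length cs"
        using \<gamma> assms by (intro sum_count_set) (auto simp: cs_def)
      ultimately show False by (simp add: cs_def M_def)
    qed
    then obtain c where "m \<le> count_list cs c" by blast
    from pword_select[OF this, where b = b] obtain v where v: "length v = M" "pword a m v"
      "\<And>j. j < m \<Longrightarrow> length (takeWhile (\<lambda>x. x < a + j) v) < M \<and>
      cs ! length (takeWhile (\<lambda>x. x < a + j) v) = c"
      unfolding a_def cs_def by auto
    have "\<chi> (subst a u (takeWhile (\<lambda>x. x < a + length u) (subst a v w))) = c"
      if u: "length u < m" "set u \<subseteq> {..<a}" for u
    proof -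
      define y where "y = takeWhile (\<lambda>x. x < a + length u) v"
      have ly: "length y < M" "\<gamma> (length y) = c" using v(3)[OF u(1)] by (auto simp: y_def cs_def)
      \<comment> \<open>Level \<open>length u\<close> of the composite is level
        \<open>length y\<close> of \<open>w\<close>, one of the selected levels.\<close>
      have "takeWhile (\<lambda>x. x < a + length u) (subst a v w) =
          subst a y (takeWhile (\<lambda>x. x < a + length y) w)"
        unfolding takeWhile_subst[OF w(2) v(1)] y_def by (metis takeWhile_eq_take)
      also have "subst a u \<dots> = subst a (subst a u y) (takeWhile (\<lambda>x. x < a + length y) w)"
        by (rule subst_assoc) (auto dest: set_takeWhileD)
      also have "\<chi> \<dots> = c"
      proof -
        have "u ! (z - a) < a" if "z \<in> set y" "a \<le> z" for z
        proof -
          have "z < a + length u" using that(1) by (auto simp: y_def dest: set_takeWhileD)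
          then have "u ! (z - a) \<in> set u" using that(2) by simp
          then show ?thesis using u(2) by auto
        qed
        then have "set (subst a u y) \<subseteq> {..<a}" by (auto simp: subst_def)
        then show ?thesis using w(3)[of "subst a u y"] ly by simp
      qed
      finally show ?thesis .
    qed
    then show "\<exists>w c. length w = L \<and> pword a m w \<and>
      (\<forall>v. length v < m \<longrightarrow> set v \<subseteq> {..<a} \<longrightarrow>
        \<chi> (subst a v (takeWhile (\<lambda>x. x < a + length v) w)) = c)"
      using w(1) pword_subst[OF w(2) v(2,1)]
      by (intro exI[of _ "subst a v w"] exI[of _ c]) simp
  qed
qed

section \<open>Induction on the number of parameters\<close>

text \<open>A \<open>(k + 1)\<close>-parameter word is a stem over \<open>{..<a}\<close>, followed by the letter \<open>a\<close> and by a
  \<open>k\<close>-parameter word over \<open>{..<Suc a}\<close>. In the induction step the words with empty stem are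
  handled by the case \<open>k\<close>, and those whose stem begins with \<open>x\<close> by the induction hypothesis over
  \<open>{..<Suc a}\<close>, for all \<open>x < a\<close> at once through tuples of colours.\<close>

lemma stem_subspace:
  assumes GR: "\<And>b m C. finite C \<Longrightarrow> arrows (Suc b) k m C"
    and "finite C"
  shows "\<exists>n. \<forall>\<chi>. range \<chi> \<subseteq> C \<longrightarrow> (\<exists>w \<delta>. length w = n \<and> pword a L w \<and>
    (\<forall>f. length f = L \<longrightarrow> pword a (Suc k) f \<longrightarrow>
      \<chi> (subst a f w) = (\<delta> (takeWhile (\<lambda>x. x < a) f) :: nat)))"
  using assms(2)
proof (induction L arbitrary: a C)
  case 0
  show ?case by (intro exI[of _ 0] allI impI exI[of _ "[]"]) auto
next
  case (Suc L)
  obtain M where M: "\<forall>\<chi>. range \<chi> \<subseteq> colour_tuples C a \<longrightarrow>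
    (\<exists>w \<delta>. length w = M \<and> pword (Suc a) L w \<and>
    (\<forall>f. length f = L \<longrightarrow> pword (Suc a) (Suc k) f \<longrightarrow>
      \<chi> (subst (Suc a) f w) = \<delta> (takeWhile (\<lambda>x. x < Suc a) f)))"
    using Suc.IH[OF finite_colour_tuples[OF Suc.prems]] ..
  obtain n where n: "\<forall>\<chi>. range \<chi> \<subseteq> C \<longrightarrow> (\<exists>w c. length w = n \<and> pword (Suc a) M w \<and>
        (\<forall>v. length v = M \<longrightarrow> pword (Suc a) k v \<longrightarrow> \<chi> (subst (Suc a) v w) = c))"
    using GR[OF Suc.prems, where b = a and m = M] unfolding arrows_def ..
  show ?case
  proof (intro exI[of _ "Suc n"] allI impI)
    fix \<chi> :: "nat list \<Rightarrow> nat" assume \<chi>: "range \<chi> \<subseteq> C"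
    \<comment> \<open>Words with empty stem begin with the parameter \<open>a\<close>, which is a
      constant for the rest.\<close>
    have "range (\<lambda>u. \<chi> (a # u)) \<subseteq> C" using \<chi> by auto
    from n[rule_format, OF this] obtain w3 c where w3: "length w3 = n" "pword (Suc a) M w3"
      "\<And>v. length v = M \<Longrightarrow> pword (Suc a) k v \<Longrightarrow> \<chi> (a # subst (Suc a) v w3) = c"
      by blast
    \<comment> \<open>\<open>D x\<close> returns from the alphabet \<open>{..<Suc a}\<close> to
      \<open>{..<a}\<close>: the letter \<open>a\<close> is read as \<open>x\<close>, and the
      parameters move down.\<close>
    define D where "D x = map (\<lambda>y. if y < a then y else if y = a then x else y - 1)" for x :: nat
    define \<chi>' where "\<chi>' h = colour_tuple a (\<lambda>x. \<chi> (x # D x (subst (Suc a) h w3)))" for h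
    have "range \<chi>' \<subseteq> colour_tuples C a"
      unfolding \<chi>'_def using \<chi> by (auto intro: colour_tuple_in)
    from M[rule_format, OF this] obtain w2 \<delta> where w2: "length w2 = M" "pword (Suc a) L w2"
      "\<And>f. length f = L \<Longrightarrow> pword (Suc a) (Suc k) f \<Longrightarrow>
        \<chi>' (subst (Suc a) f w2) = \<delta> (takeWhile (\<lambda>x. x < Suc a) f)"
      by blast
    define w where "w = subst (Suc a) w2 w3"
    have pw: "pword (Suc a) L w" using pword_subst[OF w3(2) w2(2,1)] by (simp add: w_def)
    have assoc: "subst (Suc a) g w = subst (Suc a) (subst (Suc a) g w2) w3" for g
      unfolding w_def using pword_set[OF w3(2)] w2(1) by (intro subst_assoc) auto
    \<comment> \<open>A nonempty stem finds its tuple by its tail and the component by its first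
      letter.\<close>
    define \<delta>' where "\<delta>' g = (if g = [] then c else list_decode (\<delta> (tl g)) ! hd g)" for g
    have "\<chi> (subst a f (a # w)) = \<delta>' (takeWhile (\<lambda>x. x < a) f)"
      if f: "length f = Suc L" "pword a (Suc k) f" for f
    proof -
      obtain x f' where [simp]: "f = x # f'" using f by (cases f) auto
      show ?thesis
      proof (cases "x < a")
        case True
        define g where "g = map (\<lambda>y. if y < a then y else Suc y) f'"
        have g: "pword (Suc a) (Suc k) g"
          unfolding g_def by (rule pword_rename[of a]) (use f True in auto)
        have "takeWhile (\<lambda>x. x < Suc a) g = map (\<lambda>y. if y < a then y else Suc y) (takeWhile (\<lambda>x. x < a) f')"
          unfolding g_def takeWhile_map o_def by (intro arg_cong[where f = "map _"] takeWhile_cong) auto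
        also have "\<dots> = takeWhile (\<lambda>x. x < a) f'"
          by (rule map_idI) (auto dest: set_takeWhileD)
        finally have tg: "takeWhile (\<lambda>x. x < Suc a) g = takeWhile (\<lambda>x. x < a) f'" .
        have "(if y < a then y else f ! (y - a)) =
            (\<lambda>z. if z < a then z else if z = a then x else z - 1)
              (if y < Suc a then y else g ! (y - Suc a))" if y: "y \<in> set w" for y
        proof -
          have "y < Suc a + L" using pword_set[OF pw] y by auto
          then have "y - a = Suc (y - Suc a) \<and> y - Suc a < length f'" if "a < y"
            using that f(1) by auto
          then show ?thesis by (cases y a rule: linorder_cases) (auto simp: g_def)
        qed
        then have "subst a f (a # w) = x # D x (subst (Suc a) g w)"
          unfolding subst_def D_def by simp
        also have "\<chi> \<dots> = list_decode (\<chi>' (subst (Suc a) g w2)) ! x"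
          unfolding assoc \<chi>'_def colour_tuple_nth[OF True] ..
        also have "\<chi>' (subst (Suc a) g w2) = \<delta> (takeWhile (\<lambda>x. x < a) f')"
          using w2(3)[OF _ g] f(1) by (simp add: g_def tg[unfolded g_def])
        finally show ?thesis using True by (simp add: \<delta>'_def)
      next
        case False
        then have x: "x = a" "pword (Suc a) k f'" using f by auto
        have "subst a f (a # w) = a # subst (Suc a) f' w"
          by (auto simp: subst_def x nth_Cons')
        also have "\<chi> \<dots> = c"
          unfolding assoc using pword_subst[OF w2(2) x(2)] w2(1) f(1) by (intro w3(3)) auto
        finally show ?thesis by (simp add: x \<delta>'_def)
      qed
    qed
    then show "\<exists>w \<delta>. length w = Suc n \<and> pword a (Suc L) w \<and>
      (\<forall>f. length f = Suc L \<longrightarrow> pword a (Suc k) f \<longrightarrow>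
        \<chi> (subst a f w) = \<delta> (takeWhile (\<lambda>x. x < a) f))"
      using pw w3(1) by (intro exI[of _ "a # w"] exI[of _ \<delta>']) (simp add: w_def)
  qed
qed

text \<open>Induction on \<open>k\<close>. The subspace of \<open>stem_subspace\<close> leaves a
  colouring of stems. The stem of a composite is an initial segment of \<open>w2\<close> filled with
  constants, and Carlson-Simpson makes the colouring constant on these.\<close>

theorem Graham_Rothschild:
  assumes "finite C"
  shows "arrows (Suc b) k m C"
  using assms
proof (induction k arbitrary: b m C)
  case 0
  then show ?case by (rule Hales_Jewett)
next
  case (Suc k)
  define a where "a = Suc b"
  obtain L where L: "\<forall>\<chi>. range \<chi> \<subseteq> C \<longrightarrow> (\<exists>w c. length w = L \<and> pword a m w \<and>
    (\<forall>v. length v < m \<longrightarrow> set v \<subseteq> {..<a} \<longrightarrow>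
      \<chi> (subst a v (takeWhile (\<lambda>x. x < a + length v) w)) = (c :: nat)))"
    using Carlson_Simpson[OF Suc.prems, where b = b and m = m] unfolding a_def ..
  obtain n where n: "\<forall>\<chi>. range \<chi> \<subseteq> C \<longrightarrow> (\<exists>w \<delta>. length w = n \<and> pword a L w \<and>
    (\<forall>f. length f = L \<longrightarrow> pword a (Suc k) f \<longrightarrow>
      \<chi> (subst a f w) = (\<delta> (takeWhile (\<lambda>x. x < a) f) :: nat)))"
    using stem_subspace[OF Suc.IH Suc.prems] ..
  show ?case unfolding a_def[symmetric] arrows_def
  proof (intro exI[of _ n] allI impI)
    fix \<chi> :: "nat list \<Rightarrow> nat" assume \<chi>: "range \<chi> \<subseteq> C"
    obtain w1 \<delta> where w1: "length w1 = n" "pword a L w1"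
      "\<And>f. length f = L \<Longrightarrow> pword a (Suc k) f \<Longrightarrow> \<chi> (subst a f w1) = \<delta> (takeWhile (\<lambda>x. x < a) f)"
      using n[rule_format, OF \<chi>] by blast
    \<comment> \<open>\<open>\<delta>\<close> may leave \<open>C\<close> on lists that are not
      stems; \<open>\<chi> []\<close> is a default value in \<open>C\<close>.\<close>
    define \<delta>' where "\<delta>' g = (if \<delta> g \<in> C then \<delta> g else \<chi> [])" for g
    have "range \<delta>' \<subseteq> C" using \<chi> by (auto simp: \<delta>'_def)
    from L[rule_format, OF this] obtain w2 c where w2: "length w2 = L" "pword a m w2"
      "\<And>v. length v < m \<Longrightarrow> set v \<subseteq> {..<a} \<Longrightarrow>
        \<delta>' (subst a v (takeWhile (\<lambda>x. x < a + length v) w2)) = c"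
      by blast
    have "\<chi> (subst a f (subst a w2 w1)) = c" if f: "length f = m" "pword a (Suc k) f" for f
    proof -
      define u where "u = takeWhile (\<lambda>x. x < a) f"
      \<comment> \<open>A parameter occurs in \<open>f\<close>, so its stem meets the strict length
        bound of Carlson-Simpson.\<close>
      have "a \<in> set f" using pword_set[OF f(2)] by auto
      then have "u \<noteq> f" unfolding u_def takeWhile_eq_all_conv by auto
      then have lu: "length u < m"
        unfolding u_def f(1)[symmetric] by (metis length_takeWhile_le nat_less_le takeWhile_eq_take take_all_iff order_refl)
      have u: "set u \<subseteq> {..<a}" by (auto simp: u_def dest: set_takeWhileD)
      have "takeWhile (\<lambda>x. x < a) (subst a f w2) = subst a u (takeWhile (\<lambda>x. x < a + length u) w2)"
        using takeWhile_subst[OF w2(2) f(1), of 0] unfolding u_def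
        by (simp flip: takeWhile_eq_take)
      then have "\<delta>' (takeWhile (\<lambda>x. x < a) (subst a f w2)) = c" using w2(3)[OF lu u] by simp
      moreover have "subst a f (subst a w2 w1) = subst a (subst a f w2) w1"
        using pword_set[OF w1(2)] w2(1) by (intro subst_assoc) auto
      then have "\<chi> (subst a f (subst a w2 w1)) = \<delta> (takeWhile (\<lambda>x. x < a) (subst a f w2))"
        using w1(3)[of "subst a f w2"] pword_subst[OF w2(2) f(2,1)] w2(1) by simp
      moreover from this have "\<delta> (takeWhile (\<lambda>x. x < a) (subst a f w2)) \<in> C"
        using \<chi> by (metis rangeI subsetD)
      ultimately show ?thesis by (simp add: \<delta>'_def)
    qed
    then show "\<exists>w c. length w = n \<and> pword a m w \<and>
        (\<forall>v. length v = m \<longrightarrow> pword a (Suc k) v \<longrightarrow> \<chi> (subst a v w) = c)"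
      using w1(1) pword_subst[OF w1(2) w2(2,1)]
      by (intro exI[of _ "subst a w2 w1"] exI[of _ c]) simp
  qed
qed

section \<open>Multiposets\<close>

lemma multiposetD:
  assumes "multiposet t T A" "p \<in> {1..t}"
  shows "le A p \<subseteq> points A \<times> points A" "x \<in> points A \<Longrightarrow> (x, x) \<in> le A p"
    "(x, y) \<in> le A p \<Longrightarrow> (y, z) \<in> le A p \<Longrightarrow> (x, z) \<in> le A p"
    "(x, y) \<in> le A p \<Longrightarrow> (y, x) \<in> le A p \<Longrightarrow> x = y"
proof -
  have "partial_order_on (points A) (le A p)" using assms unfolding multiposet_def by blast
  note po = partial_order_onD[OF this]
  show "le A p \<subseteq> points A \<times> points A" by (fact po(4))
  show "x \<in> points A \<Longrightarrow> (x, x) \<in> le A p" using po(1) by (simp add: refl_on_def)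
  show "(x, y) \<in> le A p \<Longrightarrow> (y, z) \<in> le A p \<Longrightarrow> (x, z) \<in> le A p" using po(2) by (rule transD)
  show "(x, y) \<in> le A p \<Longrightarrow> (y, x) \<in> le A p \<Longrightarrow> x = y" using po(3) by (rule antisymD)
qed

lemma multiposet_mono:
  "multiposet t T A \<Longrightarrow> p \<in> {1..t} \<Longrightarrow> q \<in> {1..t} \<Longrightarrow> (p, q) \<in> T \<Longrightarrow> le A p \<subseteq> le A q"
  unfolding multiposet_def by blast

lemma multiposet_total:
  assumes "multiposet t T A" "template_maximal t T i" "x \<in> points A" "y \<in> points A"
  shows "(x, y) \<in> le A i \<or> (y, x) \<in> le A i"
proof -
  have i: "i \<in> {1..t}" using assms(2) by (simp add: template_maximal_def)
  then have "total_on (points A) (le A i)"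
    using assms unfolding multiposet_def linear_order_on_def by blast
  then show ?thesis using assms(3,4) multiposetD(2)[OF assms(1) i]
    unfolding total_on_def by (cases "x = y") auto
qed

text \<open>\<open>\<sigma> p\<close> indexes a linear order extending the \<open>p\<close>-th one.
  It depends on the template alone, so the upsets of all multiposets can be listed by the same
  rule.\<close>

lemma template_maximal_above:
  assumes "template t T"
  shows "\<exists>\<sigma>. \<forall>p\<in>{1..t}. template_maximal t T (\<sigma> p) \<and> (p, \<sigma> p) \<in> T"
proof -
  have po: "partial_order_on {1..t} T" using assms by (simp add: template_def)
  note poD = partial_order_onD[OF po]
  have "finite T" using poD(4) by (rule finite_subset) simp
  then have wf: "wf ((T - Id)\<inverse>)"
    using partial_order_on_acyclic[OF po] by (intro finite_acyclic_wf_converse) auto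
  have "\<exists>i. template_maximal t T i \<and> (p, i) \<in> T" if "p \<in> {1..t}" for p
  proof -
    have "p \<in> {i. (p, i) \<in> T}" using poD(1) that by (simp add: refl_on_def)
    then obtain i where i: "(p, i) \<in> T" "\<And>j. (j, i) \<in> (T - Id)\<inverse> \<Longrightarrow> (p, j) \<notin> T"
      by (rule wfE_min[OF wf]) auto
    have "j = i" if "(i, j) \<in> T" for j
      using i that transD[OF poD(2) i(1) that] by blast
    moreover have "i \<in> {1..t}" using i(1) poD(4) by blast
    ultimately show ?thesis using i(1) unfolding template_maximal_def by blast
  qed
  then show ?thesis by metis
qed

section \<open>Upsets and their linear listing\<close>

text \<open>The empty upset is left out because the null letter stands for it.\<close>

definition upsets :: "nat \<Rightarrow> 'a ordstruct \<Rightarrow> (nat \<times> 'a set) set" where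
  "upsets t A = {(p, U). p \<in> {1..t} \<and> U \<subseteq> points A \<and> U \<noteq> {} \<and>
     (\<forall>x\<in>U. \<forall>y. (x, y) \<in> le A p \<longrightarrow> y \<in> U)}"

text \<open>In a finite linear order such an \<open>e\<close> exists iff the least element of the
  symmetric difference lies in the second set. In particular, a proper subset comes first.\<close>

definition upset_less :: "(nat \<Rightarrow> nat) \<Rightarrow> 'a ordstruct \<Rightarrow> nat \<times> 'a set \<Rightarrow> nat \<times> 'a set \<Rightarrow> bool" where
  "upset_less \<sigma> A s s' \<longleftrightarrow> fst s < fst s' \<or>
     fst s = fst s' \<and> (\<exists>e\<in>snd s' - snd s. \<forall>x\<in>snd s - snd s'. (e, x) \<in> le A (\<sigma> (fst s)))"

definition upset_list :: "nat \<Rightarrow> (nat \<Rightarrow> nat) \<Rightarrow> 'a ordstruct \<Rightarrow> (nat \<times> 'a set) list \<Rightarrow> bool" where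
  "upset_list t \<sigma> A F \<longleftrightarrow> set F = upsets t A \<and> distinct F \<and> sorted_wrt (upset_less \<sigma> A) F"

lemma upset_less_irrefl: "\<not> upset_less \<sigma> A s s"
  by (simp add: upset_less_def)

text \<open>Of the two witnesses, the one smaller in the linear order at \<open>\<sigma> p\<close>
  serves for the outer pair.\<close>

lemma upset_less_trans:
  assumes A: "multiposet t T A" and \<sigma>: "\<forall>p\<in>{1..t}. template_maximal t T (\<sigma> p) \<and> (p, \<sigma> p) \<in> T"
    and s: "s \<in> upsets t A" "s' \<in> upsets t A" "s'' \<in> upsets t A"
    and less: "upset_less \<sigma> A s s'" "upset_less \<sigma> A s' s''"
  shows "upset_less \<sigma> A s s''"
proof -
  obtain p U q V r W where [simp]: "s = (p, U)" "s' = (q, V)" "s'' = (r, W)" by (metis surj_pair)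
  show ?thesis
  proof (cases "p = q \<and> q = r")
    case False
    then show ?thesis using less by (auto simp: upset_less_def)
  next
    case True
    then have [simp]: "q = p" "r = p" by auto
    define R where "R = le A (\<sigma> p)"
    have p: "p \<in> {1..t}" and sub: "U \<subseteq> points A" "V \<subseteq> points A" "W \<subseteq> points A"
      using s by (auto simp: upsets_def)
    have \<sigma>p: "\<sigma> p \<in> {1..t}" "template_maximal t T (\<sigma> p)"
      using \<sigma> p by (auto simp: template_maximal_def)
    note D = multiposetD[OF A \<sigma>p(1), folded R_def]
    note tot = multiposet_total[OF A \<sigma>p(2), folded R_def]
    obtain d where d: "d \<in> V - U" "\<forall>x\<in>U - V. (d, x) \<in> R"
      using less(1) by (auto simp: upset_less_def R_def)
    obtain e where e: "e \<in> W - V" "\<forall>x\<in>V - W. (e, x) \<in> R"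
      using less(2) by (auto simp: upset_less_def R_def)
    have "\<exists>g\<in>W - U. \<forall>x\<in>U - W. (g, x) \<in> R"
    proof (cases "(d, e) \<in> R")
      case True
      have "d \<in> W" using True D(4) d e by blast
      moreover have "(d, x) \<in> R" if "x \<in> U - W" for x
        using that d e True D(3) by blast
      ultimately show ?thesis using d by blast
    next
      case False
      then have ed: "(e, d) \<in> R" using tot d e sub by blast
      have "e \<notin> U" using False d e by blast
      moreover have "(e, x) \<in> R" if "x \<in> U - W" for x
        using that d e ed D(3) by blast
      ultimately show ?thesis using e by blast
    qed
    then show ?thesis by (simp add: upset_less_def R_def)
  qed
qed

lemma finite_relation_minimum:
  assumes "finite S" "S \<noteq> {}"
    and "\<And>x y. x \<in> S \<Longrightarrow> y \<in> S \<Longrightarrow> (x, y) \<in> R \<or> (y, x) \<in> R"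
    and "\<And>x y z. (x, y) \<in> R \<Longrightarrow> (y, z) \<in> R \<Longrightarrow> (x, z) \<in> R"
  shows "\<exists>e\<in>S. \<forall>x\<in>S. (e, x) \<in> R"
  using assms(1-3)
proof (induction S rule: finite_ne_induct)
  case (singleton x)
  then show ?case by auto
next
  case (insert x S)
  then obtain e where e: "e \<in> S" "\<forall>y\<in>S. (e, y) \<in> R" by blast
  show ?case
  proof (cases "(e, x) \<in> R")
    case False
    then have "(x, e) \<in> R" using insert.prems[of x e] e by blast
    then show ?thesis using e assms(4) insert.prems[of x x] by blast
  qed (use e in blast)
qed

lemma upset_less_total:
  assumes A: "multiposet t T A" "finite (points A)"
    and \<sigma>: "\<forall>p\<in>{1..t}. template_maximal t T (\<sigma> p) \<and> (p, \<sigma> p) \<in> T"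
    and s: "s \<in> upsets t A" "s' \<in> upsets t A" "s \<noteq> s'"
  shows "upset_less \<sigma> A s s' \<or> upset_less \<sigma> A s' s"
proof -
  obtain p U q V where [simp]: "s = (p, U)" "s' = (q, V)" by (metis surj_pair)
  show ?thesis
  proof (cases "p = q")
    case True
    have p: "p \<in> {1..t}" and sub: "U \<subseteq> points A" "V \<subseteq> points A" using s by (auto simp: upsets_def)
    have \<sigma>p: "\<sigma> p \<in> {1..t}" "template_maximal t T (\<sigma> p)"
      using \<sigma> p by (auto simp: template_maximal_def)
    define S where "S = (U - V) \<union> (V - U)"
    have S: "S \<subseteq> points A" using sub by (auto simp: S_def)
    have "finite S" using S A(2) by (rule finite_subset)
    moreover have "S \<noteq> {}" using s(3) True by (auto simp: S_def)
    moreover have "(x, y) \<in> le A (\<sigma> p) \<or> (y, x) \<in> le A (\<sigma> p)" if "x \<in> S" "y \<in> S" for x y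
      using multiposet_total[OF A(1) \<sigma>p(2)] S that by blast
    ultimately have "\<exists>e\<in>S. \<forall>x\<in>S. (e, x) \<in> le A (\<sigma> p)"
      using multiposetD(3)[OF A(1) \<sigma>p(1)] by (rule finite_relation_minimum)
    then obtain e where "e \<in> S" "\<forall>x\<in>S. (e, x) \<in> le A (\<sigma> p)" by blast
    then show ?thesis using True by (auto simp: S_def upset_less_def)
  qed (auto simp: upset_less_def)
qed

lemma sorted_wrt_list_exists:
  assumes "finite S"
    and "\<And>x y z. x \<in> S \<Longrightarrow> y \<in> S \<Longrightarrow> z \<in> S \<Longrightarrow> R x y \<Longrightarrow> R y z \<Longrightarrow> R x z"
    and "\<And>x y. x \<in> S \<Longrightarrow> y \<in> S \<Longrightarrow> x \<noteq> y \<Longrightarrow> R x y \<or> R y x"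
  shows "\<exists>xs. set xs = S \<and> distinct xs \<and> sorted_wrt R xs"
  using assms
proof (induction S rule: finite_induct)
  case empty
  then show ?case by auto
next
  case (insert x S)
  have "\<exists>xs. set xs = S \<and> distinct xs \<and> sorted_wrt R xs"
  proof (rule insert.IH)
    show "R u z" if "u \<in> S" "y \<in> S" "z \<in> S" "R u y" "R y z" for u y z
      using insert.prems(1)[of u y z] that by simp
    show "R u y \<or> R y u" if "u \<in> S" "y \<in> S" "u \<noteq> y" for u y
      using insert.prems(2)[of u y] that by simp
  qed
  then obtain xs where xs: "set xs = S" "distinct xs" "sorted_wrt R xs" by blast
  let ?ys = "filter (\<lambda>y. R y x) xs @ [x] @ filter (\<lambda>y. \<not> R y x) xs"
  have above: "R x z" if "z \<in> S" "\<not> R z x" for z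
    using that insert.prems(2)[of x z] insert.hyps(2) by auto
  have "R y z" if "y \<in> S" "R y x" "z \<in> S" "\<not> R z x" for y z
    using above[OF that(3,4)] that insert.prems(1)[of y x z] by simp
  with above xs(1,3) have "sorted_wrt R ?ys"
    by (simp add: sorted_wrt_append sorted_wrt_filter)
  moreover have "set ?ys = insert x S" "distinct ?ys" using xs(1,2) insert.hyps by auto
  ultimately show ?case by blast
qed

lemma upset_list_exists:
  assumes "multiposet t T A" "finite (points A)"
    and "\<forall>p\<in>{1..t}. template_maximal t T (\<sigma> p) \<and> (p, \<sigma> p) \<in> T"
  shows "\<exists>F. upset_list t \<sigma> A F"
proof -
  have "upsets t A \<subseteq> {1..t} \<times> Pow (points A)" by (auto simp: upsets_def)
  then have "finite (upsets t A)" by (rule finite_subset) (use assms(2) in simp)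
  then show ?thesis unfolding upset_list_def
    using upset_less_trans[OF assms(1,3)] upset_less_total[OF assms]
    by (rule sorted_wrt_list_exists)
qed

text \<open>The head cannot exceed \<open>a\<close>, since \<open>a\<close> would have to stand
  before it; this starts the recursion. The criterion suits words whose letters are known through
  comparisons of places.\<close>

lemma pwordI:
  assumes "\<forall>x\<in>set w. x < a + k" "\<forall>x. a \<le> x \<longrightarrow> x < a + k \<longrightarrow> x \<in> set w"
    "\<And>j x. j < length w \<Longrightarrow> a \<le> x \<Longrightarrow> x < w ! j \<Longrightarrow> \<exists>j'<j. w ! j' = x"
  shows "pword a k w"
  using assms
proof (induction w arbitrary: a k)
  case Nil
  then show ?case by (metis empty_iff empty_set le_add1 less_add_same_cancel1 order_refl not_gr_zero pword.simps(1))
next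
  case (Cons x w)
  have x: "x \<le> a" using Cons.prems(3)[of 0 a] by force
  have prec: "\<exists>j'<j. w ! j' = y" if "j < length w" "a \<le> y" "y < w ! j" "y \<noteq> x" for j y
  proof -
    have "\<exists>j'<Suc j. (x # w) ! j' = y" using Cons.prems(3)[of "Suc j" y] that by simp
    then obtain j' where "j' < Suc j" "(x # w) ! j' = y" by blast
    then show ?thesis using that(4) by (cases j') auto
  qed
  show ?case
  proof (cases "x = a")
    case False
    with x have "x < a" by simp
    have "pword a k w"
    proof (rule Cons.IH)
      show "\<forall>y. a \<le> y \<longrightarrow> y < a + k \<longrightarrow> y \<in> set w" using Cons.prems(2) \<open>x < a\<close> by fastforce
      show "\<exists>j'<j. w ! j' = y" if "j < length w" "a \<le> y" "y < w ! j" for j y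
        using prec that \<open>x < a\<close> by simp
    qed (use Cons.prems in auto)
    with \<open>x < a\<close> show ?thesis by simp
  next
    case True
    with Cons.prems(1) obtain k' where k: "k = Suc k'" by (cases k) auto
    have "pword (Suc a) k' w"
    proof (rule Cons.IH)
      show "\<forall>y. Suc a \<le> y \<longrightarrow> y < Suc a + k' \<longrightarrow> y \<in> set w"
      proof (intro allI impI)
        fix y assume y: "Suc a \<le> y" "y < Suc a + k'"
        then have "y \<in> set (x # w)" using Cons.prems(2) k by simp
        then show "y \<in> set w" using y True by simp
      qed
      show "\<exists>j'<j. w ! j' = y" if "j < length w" "Suc a \<le> y" "y < w ! j" for j y
        using prec that True by simp
    qed (use Cons.prems k in auto)
    with True k show ?thesis by simp
  qed
qed

section \<open>Traces of points and the host multiposet\<close>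

text \<open>The only constant is the null letter \<open>0\<close>, and the parameter
  \<open>Suc i\<close> stands for \<open>F ! i\<close>, hence the subtraction of one.\<close>

definition trace :: "(nat \<times> 'a set) list \<Rightarrow> nat list \<Rightarrow> 'a \<Rightarrow> nat \<Rightarrow> nat set" where
  "trace F w a p = {j. j < length w \<and> 0 < w ! j \<and> (\<exists>U. F ! (w ! j - 1) = (p, U) \<and> a \<in> U)}"

text \<open>All parameters occur in \<open>w\<close>, in particular the letter of the principal
  upset of \<open>a\<close>, whose places detect whether \<open>b\<close> is above \<open>a\<close>.
  The converse is closure of upsets.\<close>

lemma trace_subset_iff:
  assumes A: "multiposet t T A" and F: "set F = upsets t A" and w: "pword 1 (length F) w"
    and ab: "a \<in> points A" "b \<in> points A" and p: "p \<in> {1..t}"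
  shows "trace F w a p \<subseteq> trace F w b p \<longleftrightarrow> (a, b) \<in> le A p"
proof
  assume sub: "trace F w a p \<subseteq> trace F w b p"
  define U where "U = {x. (a, x) \<in> le A p}"
  have "(p, U) \<in> upsets t A"
    using multiposetD[OF A p] ab p unfolding upsets_def U_def by blast
  then obtain i where i: "i < length F" "F ! i = (p, U)" using F by (metis in_set_conv_nth)
  then have "Suc i \<in> set w" using pword_set[OF w] by auto
  then obtain j where j: "j < length w" "w ! j = Suc i" by (metis in_set_conv_nth)
  have "j \<in> trace F w a p" using i j multiposetD(2)[OF A p ab(1)] by (auto simp: trace_def U_def)
  with sub have "j \<in> trace F w b p" by blast
  then show "(a, b) \<in> le A p" using i j by (auto simp: trace_def U_def)
next
  assume le: "(a, b) \<in> le A p"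
  show "trace F w a p \<subseteq> trace F w b p"
  proof
    fix j assume "j \<in> trace F w a p"
    then obtain U where j: "j < length w" "0 < w ! j" "F ! (w ! j - 1) = (p, U)" "a \<in> U"
      by (auto simp: trace_def)
    have "w ! j < 1 + length F" using j(1) pword_set[OF w] nth_mem by blast
    then have "(p, U) \<in> set F" using j(2,3) by (metis One_nat_def Suc_pred less_Suc_eq_le nth_mem plus_1_eq_Suc Suc_less_eq)
    then have "b \<in> U" using F le j(4) by (auto simp: upsets_def)
    with j show "j \<in> trace F w b p" by (auto simp: trace_def)
  qed
qed

lemma trace_subset_lessThan: "trace F w a p \<subseteq> {..<length w}"
  by (auto simp: trace_def)

text \<open>On a maximal order the second component \<open>x < y\<close> only breaks ties; it makes the order
  total on points that are not traces of a common word.\<close>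

definition host :: "nat \<Rightarrow> nat rel \<Rightarrow> nat set \<Rightarrow> (nat \<Rightarrow> nat \<Rightarrow> nat set) \<Rightarrow> nat ordstruct" where
  "host t T S h = \<lparr>points = S, le = \<lambda>q. {(x, y) \<in> S \<times> S. x = y \<or>
     (if template_maximal t T q
      then card (h x q) < card (h y q) \<or> card (h x q) = card (h y q) \<and> x < y
      else \<forall>p\<in>{1..t}. (q, p) \<in> T \<longrightarrow> h x p \<subset> h y p)}\<rparr>"

text \<open>A nonmaximal order asks for strict inclusion at all indices above its own, so
  transitivity of \<open>T\<close> makes these orders grow along the template. Strict inclusion of
  finite sets raises the cardinality, which covers the passage to a maximal index.\<close>

lemma multiposet_host:
  assumes T: "template t T" and fin: "\<And>x q. x \<in> S \<Longrightarrow> q \<in> {1..t} \<Longrightarrow> finite (h x q)"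
  shows "multiposet t T (host t T S h)"
proof -
  have po: "partial_order_on {1..t} T" using T by (simp add: template_def)
  note poD = partial_order_onD[OF po]
  have refl: "(q, q) \<in> T" if "q \<in> {1..t}" for q using poD(1) that by (simp add: refl_on_def)
  have partial: "partial_order_on S (le (host t T S h) q)" if q: "q \<in> {1..t}" for q
    unfolding partial_order_on_def preorder_on_def
  proof (intro conjI)
    show "trans (le (host t T S h) q)"
    proof (rule transI)
      fix x y z assume xyz: "(x, y) \<in> le (host t T S h) q" "(y, z) \<in> le (host t T S h) q"
      show "(x, z) \<in> le (host t T S h) q"
      proof (cases "x = y \<or> y = z \<or> template_maximal t T q")
        case False
        then have "h x p \<subset> h z p" if "p \<in> {1..t}" "(q, p) \<in> T" for p
          using xyz that psubset_trans[of "h x p" "h y p" "h z p"] by (simp add: host_def)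
        then show ?thesis using xyz False by (simp add: host_def)
      qed (use xyz in \<open>auto simp: host_def split: if_splits\<close>)
    qed
    show "antisym (le (host t T S h) q)"
    proof (rule antisymI)
      fix x y assume xy: "(x, y) \<in> le (host t T S h) q" "(y, x) \<in> le (host t T S h) q"
      show "x = y"
      proof (cases "template_maximal t T q")
        case False
        show ?thesis
        proof (rule ccontr)
          assume "x \<noteq> y"
          then have "h x q \<subset> h y q" "h y q \<subset> h x q"
            using xy False refl[OF q] q by (simp_all add: host_def)
          then show False by blast
        qed
      qed (use xy in \<open>auto simp: host_def\<close>)
    qed
  qed (auto simp: host_def refl_on_def)
  have "linear_order_on S (le (host t T S h) q)" if "template_maximal t T q" for q
  proof -
    have "q \<in> {1..t}" using that by (simp add: template_maximal_def)
    moreover have "total_on S (le (host t T S h) q)"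
      using that by (auto simp: total_on_def host_def)
    ultimately show ?thesis using partial by (simp add: linear_order_on_def)
  qed
  moreover have "le (host t T S h) i \<subseteq> le (host t T S h) j"
    if ij: "i \<in> {1..t}" "j \<in> {1..t}" "(i, j) \<in> T" for i j
  proof (cases "template_maximal t T i")
    case True
    then show ?thesis using ij by (auto simp: template_maximal_def)
  next
    case False
    show ?thesis
    proof (rule subrelI)
      fix x y assume xy: "(x, y) \<in> le (host t T S h) i"
      then have S: "x \<in> S" "y \<in> S" by (auto simp: host_def)
      show "(x, y) \<in> le (host t T S h) j"
      proof (cases "x = y")
        case True
        then show ?thesis using S by (simp add: host_def)
      next
        case neq: False
        then have lt: "h x p \<subset> h y p" if "p \<in> {1..t}" "(i, p) \<in> T" for p
          using xy False that by (auto simp: host_def)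
        show ?thesis
        proof (cases "template_maximal t T j")
          case True
          then show ?thesis
            using S psubset_card_mono[OF fin[OF S(2) ij(2)] lt[OF ij(2,3)]] by (simp add: host_def)
        next
          case False
          have "h x p \<subset> h y p" if "p \<in> {1..t}" "(j, p) \<in> T" for p
            using lt that transD[OF poD(2) ij(3) that(2)] by blast
          then show ?thesis using S False by (simp add: host_def)
        qed
      qed
    qed
  qed
  ultimately show ?thesis using partial unfolding multiposet_def by (simp add: host_def)
qed

text \<open>For traces of one word, strict inclusion at \<open>p\<close> is the strict
  \<open>p\<close>-th order. At a maximal index the traces form a chain, so comparing cardinalities
  compares the traces and no ties arise between distinct points.\<close>

lemma embedding_host:
  assumes A: "multiposet t T A" and T: "template t T"
    and F: "set F = upsets t A" and w: "pword 1 (length F) w"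
    and \<phi>: "\<And>a. a \<in> points A \<Longrightarrow> \<phi> a \<in> S"
      "\<And>a p. a \<in> points A \<Longrightarrow> p \<in> {1..t} \<Longrightarrow> h (\<phi> a) p = trace F w a p"
  shows "embedding t A (host t T S h) \<phi>"
proof -
  have po: "partial_order_on {1..t} T" using T by (simp add: template_def)
  note poD = partial_order_onD[OF po]
  have iff: "h (\<phi> a) p \<subseteq> h (\<phi> b) p \<longleftrightarrow> (a, b) \<in> le A p"
    if "a \<in> points A" "b \<in> points A" "p \<in> {1..t}" for a b p
    using trace_subset_iff[OF A F w that] \<phi>(2) that by simp
  have t: "1 \<in> {1..t}" using T by (simp add: template_def)
  have eq: "\<phi> a = \<phi> b \<longleftrightarrow> a = b" if "a \<in> points A" "b \<in> points A" for a b
    using iff[OF that t] iff[OF that(2,1) t] multiposetD(4)[OF A t] by fastforce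
  have less: "h (\<phi> a) p \<subset> h (\<phi> b) p \<longleftrightarrow> (a, b) \<in> le A p \<and> a \<noteq> b"
    if "a \<in> points A" "b \<in> points A" "p \<in> {1..t}" for a b p
    using iff[OF that] iff[OF that(2,1,3)] multiposetD(4)[OF A that(3), of a b]
      multiposetD(2)[OF A that(3)] that unfolding psubset_eq by (metis subset_antisym order_refl)
  have "(a, b) \<in> le A q \<longleftrightarrow> (\<phi> a, \<phi> b) \<in> le (host t T S h) q"
    if ab: "a \<in> points A" "b \<in> points A" and q: "q \<in> {1..t}" for a b q
  proof (cases "a = b")
    case True
    then show ?thesis using multiposetD(2)[OF A q ab(1)] \<phi>(1)[OF ab(1)] by (simp add: host_def)
  next
    case neq: False
    show ?thesis
    proof (cases "template_maximal t T q")
      case True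
      have fin: "finite (h (\<phi> c) q)" if "c \<in> points A" for c
        using \<phi>(2)[OF that q] by (simp add: trace_def)
      have lt: "card (h (\<phi> a) q) < card (h (\<phi> b) q)"
        if "a \<in> points A" "b \<in> points A" "(a, b) \<in> le A q" "a \<noteq> b" for a b
        using psubset_card_mono[OF fin[OF that(2)]] less[OF that(1,2) q] that by blast
      show ?thesis
      proof (cases "(a, b) \<in> le A q")
        case True
        then show ?thesis using lt[OF ab] neq \<open>template_maximal t T q\<close> \<phi>(1) ab by (simp add: host_def)
      next
        case False
        then have "(b, a) \<in> le A q" using multiposet_total[OF A True] ab by blast
        then show ?thesis using False lt[OF ab(2,1)] neq \<open>template_maximal t T q\<close> eq[OF ab]
          by (simp add: host_def)
      qed
    next
      case False
      have "(a, b) \<in> le A q \<longleftrightarrow> (\<forall>p\<in>{1..t}. (q, p) \<in> T \<longrightarrow> (a, b) \<in> le A p)"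
        using multiposet_mono[OF A q] poD(1) q unfolding refl_on_def by blast
      then show ?thesis using False less[OF ab] neq eq[OF ab] \<phi>(1) ab by (simp add: host_def)
    qed
  qed
  moreover have "\<phi> \<in> points A \<rightarrow> points (host t T S h)" using \<phi>(1) by (simp add: host_def)
  moreover have "inj_on \<phi> (points A)" using eq by (simp add: inj_on_def)
  ultimately show ?thesis unfolding embedding_def by blast
qed

section \<open>Pulling back upsets along an embedding\<close>

text \<open>\<open>Suc\<close> reserves \<open>0\<close> for the empty preimage. \<open>SOME\<close>
  looks up an index, which is unique when \<open>F\<close> is distinct.\<close>

definition pullback_word :: "(nat \<times> 'a set) list \<Rightarrow> (nat \<times> 'b set) list \<Rightarrow> 'a set \<Rightarrow> ('a \<Rightarrow> 'b) \<Rightarrow> nat list" where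
  "pullback_word F G X f = map (\<lambda>(p, U). let V = {a \<in> X. f a \<in> U} in
     if V = {} then 0 else Suc (SOME i. i < length F \<and> F ! i = (p, V))) G"

lemma length_pullback_word [simp]: "length (pullback_word F G X f) = length G"
  by (simp add: pullback_word_def)

lemma pullback_word_nth:
  assumes A: "multiposet t T A" and B: "multiposet t T B" and f: "embedding t A B f"
    and F: "set F = upsets t A" and G: "set G = upsets t B"
    and i: "i < length G" "G ! i = (p, U)"
  defines "V \<equiv> {a \<in> points A. f a \<in> U}"
  shows "V = {} \<and> pullback_word F G (points A) f ! i = 0 \<or>
    V \<noteq> {} \<and> (\<exists>k<length F. pullback_word F G (points A) f ! i = Suc k \<and> F ! k = (p, V))"
proof (cases "V = {}")
  case True
  then show ?thesis using i by (simp add: pullback_word_def V_def)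
next
  case False
  have "(p, U) \<in> upsets t B" using i G nth_mem by metis
  then have pU: "p \<in> {1..t}" "\<forall>x\<in>U. \<forall>y. (x, y) \<in> le B p \<longrightarrow> y \<in> U" by (auto simp: upsets_def)
  have "(p, V) \<in> upsets t A"
    using False pU f multiposetD(1)[OF A pU(1)] unfolding upsets_def V_def embedding_def by blast
  then have "\<exists>k. k < length F \<and> F ! k = (p, V)" using F by (metis in_set_conv_nth)
  then have "(SOME k. k < length F \<and> F ! k = (p, V)) < length F \<and> F ! (SOME k. k < length F \<and> F ! k = (p, V)) = (p, V)"
    by (rule someI_ex)
  moreover have "pullback_word F G (points A) f ! i = Suc (SOME k. k < length F \<and> F ! k = (p, V))"
    using False i unfolding V_def by (simp add: pullback_word_def)
  ultimately show ?thesis using False by blast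
qed

text \<open>The first pair of \<open>G\<close> whose pullback is \<open>(p, V)\<close> is given by the upset generated by
  \<open>f ` V\<close>, and generating upsets preserves the order on pairs.\<close>

lemma pword_pullback_word:
  assumes A: "multiposet t T A" and B: "multiposet t T B" and f: "embedding t A B f"
    and \<sigma>: "\<forall>p\<in>{1..t}. template_maximal t T (\<sigma> p) \<and> (p, \<sigma> p) \<in> T"
    and F: "upset_list t \<sigma> A F" and G: "upset_list t \<sigma> B G"
  shows "pword 1 (length F) (pullback_word F G (points A) f)"
proof -
  define v where "v = pullback_word F G (points A) f"
  have sF: "set F = upsets t A" and sG: "set G = upsets t B"
    using F G by (auto simp: upset_list_def)
  note nth = pullback_word_nth[OF A B f sF sG, folded v_def]
  have lv: "length v = length G" by (simp add: v_def)
  have f_le: "(a, a') \<in> le A p \<longleftrightarrow> (f a, f a') \<in> le B p"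
    if "a \<in> points A" "a' \<in> points A" "p \<in> {1..t}" for a a' p
    using f that unfolding embedding_def by blast
  have fB: "f a \<in> points B" if "a \<in> points A" for a using f that unfolding embedding_def by blast
  define gen where "gen p V = {y. \<exists>a\<in>V. (f a, y) \<in> le B p}" for p V
  have gen: "\<exists>j<length G. G ! j = (p, gen p V) \<and> v ! j = Suc k"
    if k: "k < length F" "F ! k = (p, V)" for k p V
  proof -
    have pV: "p \<in> {1..t}" "V \<subseteq> points A" "V \<noteq> {}" "\<forall>x\<in>V. \<forall>y. (x, y) \<in> le A p \<longrightarrow> y \<in> V"
      using k sF nth_mem[of k F] by (auto simp: upsets_def)
    note BD = multiposetD[OF B pV(1)]
    have sub: "f ` V \<subseteq> gen p V" using BD(2) fB pV(2) by (auto simp: gen_def)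
    have "(p, gen p V) \<in> upsets t B"
      using pV sub BD(1,3) unfolding upsets_def gen_def by blast
    then obtain j where j: "j < length G" "G ! j = (p, gen p V)" using sG by (metis in_set_conv_nth)
    \<comment> \<open>An embedding reflects the order and \<open>V\<close> is an upset, so
      generating adds no image of a new point.\<close>
    have "{a \<in> points A. f a \<in> gen p V} = V"
      using pV sub f_le[OF _ _ pV(1)] unfolding gen_def by blast
    then obtain k' where "k' < length F" "v ! j = Suc k'" "F ! k' = (p, V)"
      using nth[OF j] pV(3) by auto
    moreover have "k' = k"
      using F calculation k nth_eq_iff_index_eq[of F k' k] by (simp add: upset_list_def)
    ultimately show ?thesis using j by blast
  qed
  show ?thesis unfolding v_def[symmetric]
  proof (rule pwordI)
    show "\<forall>x\<in>set v. x < 1 + length F"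
    proof
      fix x assume "x \<in> set v"
      then obtain j where j: "j < length G" "x = v ! j" using lv by (metis in_set_conv_nth)
      obtain p U where "G ! j = (p, U)" by fastforce
      from nth[OF j(1) this] j(2) show "x < 1 + length F" by auto
    qed
    show "\<forall>x. 1 \<le> x \<longrightarrow> x < 1 + length F \<longrightarrow> x \<in> set v"
    proof (intro allI impI)
      fix x assume x: "1 \<le> x" "x < 1 + length F"
      obtain p V where pV: "F ! (x - 1) = (p, V)" by fastforce
      have "x - 1 < length F" using x by linarith
      from gen[OF this pV] x obtain j where "j < length G" "v ! j = x" by auto
      then show "x \<in> set v" using lv by (metis nth_mem)
    qed
    fix j x assume j: "j < length v" and x: "1 \<le> x" "x < v ! j"
    obtain p U where pU: "G ! j = (p, U)" by fastforce
    define V where "V = {a \<in> points A. f a \<in> U}"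
    obtain k where k: "k < length F" "v ! j = Suc k" "F ! k = (p, V)"
      using nth[OF _ pU] j lv x unfolding V_def by auto
    define k' where "k' = x - 1"
    have k': "k' < k" "x = Suc k'" using x k by (auto simp: k'_def)
    obtain p' V' where pV': "F ! k' = (p', V')" by fastforce
    obtain j' where j': "j' < length G" "G ! j' = (p', gen p' V')" "v ! j' = x"
      using gen[OF _ pV'] k' k(1) by auto
    have less: "upset_less \<sigma> A (p', V') (p, V)"
      using F k' k pV' sorted_wrt_nth_less[of "upset_less \<sigma> A" F k' k] by (simp add: upset_list_def)
    have pV'2: "p' \<in> {1..t}" "V' \<subseteq> points A" "\<forall>x\<in>V'. \<forall>y. (x, y) \<in> le A p' \<longrightarrow> y \<in> V'"
      using k' k(1) pV' sF nth_mem[of k' F] by (auto simp: upsets_def)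
    have pU2: "p \<in> {1..t}" "U \<subseteq> points B" "\<forall>x\<in>U. \<forall>y. (x, y) \<in> le B p \<longrightarrow> y \<in> U"
      using pU j lv sG nth_mem[of j G] by (auto simp: upsets_def)
    \<comment> \<open>The witness \<open>e\<close> for \<open>V'\<close> and \<open>V\<close> yields
      the witness \<open>f e\<close>. A point \<open>y\<close> of \<open>gen p V' - U\<close> lies
      above some \<open>f a\<close> with \<open>a\<close> in \<open>V' - V\<close>; then
      \<open>f e\<close> is below \<open>f a\<close> and, as \<open>\<sigma> p\<close> is above
      \<open>p\<close>, \<open>f a\<close> is below \<open>y\<close> in the linear order.\<close>
    have lessB: "upset_less \<sigma> B (p', gen p' V') (p, U)"
    proof (cases "p' = p")
      case False
      then show ?thesis using less by (simp add: upset_less_def)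
    next
      case True
      have \<sigma>p: "\<sigma> p \<in> {1..t}" "(p, \<sigma> p) \<in> T"
        using \<sigma> pU2(1) by (auto simp: template_maximal_def)
      obtain e where e: "e \<in> V - V'" "\<forall>x\<in>V' - V. (e, x) \<in> le A (\<sigma> p)"
        using less True by (auto simp: upset_less_def)
      have eA: "e \<in> points A" "f e \<in> U" using e by (auto simp: V_def)
      have "f e \<notin> gen p V'"
        using e(1) eA(1) pV'2 f_le[OF _ _ pU2(1)] True unfolding gen_def by blast
      moreover have "(f e, y) \<in> le B (\<sigma> p)" if y: "y \<in> gen p V' - U" for y
      proof -
        obtain a where a: "a \<in> V'" "(f a, y) \<in> le B p" using y by (auto simp: gen_def)
        have aA: "a \<in> points A" using a pV'2 by blast
        have "a \<notin> V" using a y pU2(3) by (auto simp: V_def)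
        then have "(e, a) \<in> le A (\<sigma> p)" using e a by blast
        then have "(f e, f a) \<in> le B (\<sigma> p)" using f_le[OF eA(1) aA \<sigma>p(1)] by blast
        moreover have "(f a, y) \<in> le B (\<sigma> p)"
          using a(2) multiposet_mono[OF B pU2(1) \<sigma>p] by blast
        ultimately show ?thesis by (rule multiposetD(3)[OF B \<sigma>p(1)])
      qed
      ultimately show ?thesis using True eA(2) by (auto simp: upset_less_def)
    qed
    have "\<not> j \<le> j'"
    proof
      assume "j \<le> j'"
      then consider "j = j'" | "j < j'" by linarith
      then show False
      proof cases
        case 1
        then show False using lessB pU j'(2) upset_less_irrefl by metis
      next
        case 2
        then have "upset_less \<sigma> B (p, U) (p', gen p' V')"
          using G j'(1,2) pU sorted_wrt_nth_less[of "upset_less \<sigma> B" G j j']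
          by (simp add: upset_list_def)
        then have "upset_less \<sigma> B (p, U) (p, U)"
          using upset_less_trans[OF B \<sigma>, of "(p, U)" "(p', gen p' V')" "(p, U)"] lessB
            pU j j' lv sG nth_mem by metis
        then show False using upset_less_irrefl by blast
      qed
    qed
    then have "j' < j" by simp
    then show "\<exists>j'<j. v ! j' = x" using j'(3) by blast
  qed
qed

text \<open>At each place, \<open>f a\<close> lies in the upset of \<open>B\<close> iff
  \<open>a\<close> lies in its preimage, and an empty preimage contributes to neither side. Hence
  the copy given by the substituted word lies inside the copy given by \<open>w\<close>.\<close>

lemma trace_subst_pullback_word:
  assumes A: "multiposet t T A" and B: "multiposet t T B" and f: "embedding t A B f"
    and F: "set F = upsets t A" and G: "set G = upsets t B"
    and w: "pword 1 (length G) w" and a: "a \<in> points A"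
  shows "trace F (subst 1 (pullback_word F G (points A) f) w) a p = trace G w (f a) p"
proof -
  define v where "v = pullback_word F G (points A) f"
  have eq: "(0 < subst 1 v w ! j \<and> (\<exists>V. F ! (subst 1 v w ! j - 1) = (p, V) \<and> a \<in> V)) \<longleftrightarrow>
      (0 < w ! j \<and> (\<exists>U. G ! (w ! j - 1) = (p, U) \<and> f a \<in> U))" if j: "j < length w" for j
  proof (cases "w ! j")
    case 0
    then show ?thesis using j by (simp add: subst_def)
  next
    case (Suc i)
    have "w ! j < 1 + length G" using j pword_set[OF w] nth_mem by blast
    then have i: "i < length G" using Suc by simp
    obtain q U where qU: "G ! i = (q, U)" by fastforce
    have "subst 1 v w ! j = v ! i" using j Suc by (simp add: subst_def)
    then show ?thesis using pullback_word_nth[OF A B f F G i qU, folded v_def] qU Suc a by auto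
  qed
  show ?thesis unfolding trace_def v_def[symmetric] length_subst
    by (rule Collect_cong, rule conj_cong[OF refl], rule eq)
qed

section \<open>The Ramsey property of multiposets\<close>

theorem theorem1p2:
  fixes t k :: nat and T :: "nat rel"
    and \<A> :: "'a ordstruct" and \<B> :: "'b ordstruct"
  assumes "template t T"
    and "k \<ge> 2"
    and "\<A> \<in> fin_multiposets t T" and "\<B> \<in> fin_multiposets t T"
    and "embeds t \<A> \<B>"
  shows "\<exists>\<C> :: nat ordstruct. \<C> \<in> fin_multiposets t T \<and>
    (\<forall>\<chi> \<in> copies t \<A> \<C> \<rightarrow> {..<k}. \<exists>\<B>' \<in> copies t \<B> \<C>. \<exists>c.
       \<forall>\<A>' \<in> copies t \<A> \<C>. points \<A>' \<subseteq> points \<B>' \<longrightarrow> \<chi> \<A>' = c)"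
proof -
  have A: "multiposet t T \<A>" "finite (points \<A>)" and B: "multiposet t T \<B>" "finite (points \<B>)"
    using assms by (auto simp: fin_multiposets_def)
  obtain \<sigma> where \<sigma>: "\<forall>p\<in>{1..t}. template_maximal t T (\<sigma> p) \<and> (p, \<sigma> p) \<in> T"
    using template_maximal_above[OF assms(1)] by blast
  obtain F where F: "upset_list t \<sigma> \<A> F" using upset_list_exists[OF A \<sigma>] by blast
  obtain G where G: "upset_list t \<sigma> \<B> G" using upset_list_exists[OF B \<sigma>] by blast
  have sF: "set F = upsets t \<A>" and sG: "set G = upsets t \<B>"
    using F G by (auto simp: upset_list_def)
  obtain n where n: "\<forall>\<chi>. range \<chi> \<subseteq> {..<k} \<longrightarrow> (\<exists>w c. length w = n \<and> pword 1 (length G) w \<and>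
     (\<forall>v. length v = length G \<longrightarrow> pword 1 (length F) v \<longrightarrow> \<chi> (subst 1 v w) = c))"
    using Graham_Rothschild[of "{..<k}" 0 "length F" "length G"] unfolding arrows_def One_nat_def
    by auto
  \<comment> \<open>The points of the host are all families of subsets of \<open>{..<n}\<close>
    indexed by the template, numbered by \<open>h\<close> because they have to be natural
    numbers.\<close>
  define P where "P = ({1..t} \<rightarrow>\<^sub>E Pow {..<n})"
  have "finite P" unfolding P_def by (intro finite_PiE) auto
  then obtain h where h: "bij_betw h {0..<card P} P" using ex_bij_betw_nat_finite by blast
  define S where "S = {0..<card P}"
  define \<C> where "\<C> = host t T S h"
  have hP: "h x \<in> P" if "x \<in> S" for x using h that by (auto simp: S_def bij_betw_def)
  have finh: "finite (h x q)" if "x \<in> S" "q \<in> {1..t}" for x q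
    using hP[OF that(1)] that(2) unfolding P_def by (auto dest!: PiE_mem intro: finite_subset)
  have C: "\<C> \<in> fin_multiposets t T"
    using multiposet_host[OF assms(1), of S h] finh by (auto simp: fin_multiposets_def \<C>_def host_def S_def)
  define pt where "pt r = inv_into S h (\<lambda>p\<in>{1..t}. r p)" for r
  have pt: "pt r \<in> S" "\<And>p. p \<in> {1..t} \<Longrightarrow> h (pt r) p = r p" if "\<And>p. r p \<subseteq> {..<n}" for r
  proof -
    have "(\<lambda>p\<in>{1..t}. r p) \<in> h ` S"
      using h that by (auto simp: bij_betw_def S_def P_def)
    from inv_into_into[OF this] f_inv_into_f[OF this]
    show "pt r \<in> S" "\<And>p. p \<in> {1..t} \<Longrightarrow> h (pt r) p = r p" by (auto simp: pt_def)
  qed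
  define \<phi> where "\<phi> w a = pt (trace F w a)" for w a
  define \<psi> where "\<psi> w b = pt (trace G w b)" for w b
  have \<phi>: "embedding t \<A> \<C> (\<phi> w)" if "length w = n" "pword 1 (length F) w" for w
    unfolding \<C>_def \<phi>_def
    using pt[of "trace F w _"] trace_subset_lessThan[of F w] that(1)
    by (intro embedding_host[OF A(1) assms(1) sF that(2)]) auto
  have \<psi>: "embedding t \<B> \<C> (\<psi> w)" if "length w = n" "pword 1 (length G) w" for w
    unfolding \<C>_def \<psi>_def
    using pt[of "trace G w _"] trace_subset_lessThan[of G w] that(1)
    by (intro embedding_host[OF B(1) assms(1) sG that(2)]) auto
  have "\<exists>\<B>' \<in> copies t \<B> \<C>. \<exists>c. \<forall>\<A>' \<in> copies t \<A> \<C>. points \<A>' \<subseteq> points \<B>' \<longrightarrow> \<chi> \<A>' = c"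
    if \<chi>: "\<chi> \<in> copies t \<A> \<C> \<rightarrow> {..<k}" for \<chi>
  proof -
    \<comment> \<open>The default \<open>0\<close> is a colour since \<open>k\<close> is
      positive.\<close>
    define \<chi>' where "\<chi>' u = (if length u = n \<and> pword 1 (length F) u
      then \<chi> (substructure \<C> (\<phi> u ` points \<A>)) else 0)" for u
    have "range \<chi>' \<subseteq> {..<k}"
      using \<chi> \<phi> assms(2) unfolding \<chi>'_def copies_eq_embedding_images by auto
    with n obtain w c where w: "length w = n" "pword 1 (length G) w"
      "\<And>v. length v = length G \<Longrightarrow> pword 1 (length F) v \<Longrightarrow> \<chi>' (subst 1 v w) = c"
      by metis
    define \<B>' where "\<B>' = substructure \<C> (\<psi> w ` points \<B>)"
    have "\<B>' \<in> copies t \<B> \<C>"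
      using \<psi>[OF w(1,2)] unfolding \<B>'_def copies_eq_embedding_images by blast
    moreover have "\<chi> \<A>' = c" if A': "\<A>' \<in> copies t \<A> \<C>" "points \<A>' \<subseteq> points \<B>'" for \<A>'
    proof -
      obtain g where g: "\<A>' = substructure \<C> (g ` points \<A>)" "embedding t \<A> \<C> g"
        using A'(1) unfolding copies_eq_embedding_images by blast
      have sub: "g ` points \<A> \<subseteq> \<psi> w ` points \<B>"
        using A'(2) by (simp add: g(1) \<B>'_def substructure_def)
      \<comment> \<open>Every embedding \<open>g\<close> with image inside the copy of
        \<open>\<B>\<close> factors through \<open>\<psi> w\<close>, and \<open>f\<close> is the
        other factor.\<close>
      define f where "f a = inv_into (points \<B>) (\<psi> w) (g a)" for a
      have f: "f a \<in> points \<B>" "\<psi> w (f a) = g a" if "a \<in> points \<A>" for a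
      proof -
        have "g a \<in> \<psi> w ` points \<B>" using sub that by blast
        from inv_into_into[OF this] f_inv_into_f[OF this]
        show "f a \<in> points \<B>" "\<psi> w (f a) = g a" by (auto simp: f_def)
      qed
      have "inj_on f (points \<A>)"
        using g(2) f(2) unfolding embedding_def inj_on_def by metis
      moreover have "(a, a') \<in> le \<A> i \<longleftrightarrow> (f a, f a') \<in> le \<B> i"
        if "i \<in> {1..t}" "a \<in> points \<A>" "a' \<in> points \<A>" for i a a'
        using g(2) \<psi>[OF w(1,2)] f that unfolding embedding_def by metis
      ultimately have emb: "embedding t \<A> \<B> f" using f(1) unfolding embedding_def by blast
      define v where "v = pullback_word F G (points \<A>) f"
      have v: "pword 1 (length F) v" "length v = length G"
        using pword_pullback_word[OF A(1) B(1) emb \<sigma> F G] by (simp_all add: v_def)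
      \<comment> \<open>Both points have the same trace, so the given copy of \<open>\<A>\<close> is
        the one coded by a word on which \<open>\<chi>'\<close> is constant.\<close>
      have "\<phi> (subst 1 v w) a = g a" if "a \<in> points \<A>" for a
        using trace_subst_pullback_word[OF A(1) B(1) emb sF sG w(2) that] f(2)[OF that]
        unfolding \<phi>_def \<psi>_def v_def by presburger
      then have "\<phi> (subst 1 v w) ` points \<A> = g ` points \<A>" by (rule image_cong[OF refl])
      then have "\<chi> \<A>' = \<chi>' (subst 1 v w)"
        using pword_subst[OF w(2) v] w(1) by (simp add: \<chi>'_def g(1))
      then show ?thesis using w(3) v by simp
    qed
    ultimately show ?thesis by blast
  qed
  with C show ?thesis by (intro exI[of _ \<C>] conjI ballI)
qed

end
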